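(* Let $X$ be a Euclidean space and let $f : X \to \mathbf{R}$ be a locally Lipschitz function that is a strong $C^2$ max function at a point $\bar x \in X$, with active manifold $M$. Then $f$ grows robustly relative to $M$ at $\bar x$, and hence its Goldstein modulus grows linearly at $\bar x$: there exists a constant $\alpha > 0$ such that $\Gamma f(x) \ge \alpha|x - \bar x|$ for all $x \in X$ near $\bar x$.
   Context: $X$ is a finite-dimensional Euclidean space with inner product $\langle\cdot,\cdot\rangle$, norm $|\cdot|$ and closed unit ball $B$. For a locally Lipschitz $f : X \to \mathbf{R}$, the Clarke subdifferential $\partial f(x)$ is the closed convex hull of all limits $\lim_r \nabla f(x_r)$ arising from sequences $x_r \to x$ of points of differentiability. The point $x$ is Clarke critical when $0 \in \partial f(x)$. For $\epsilon \ge 0$, $\partial_\epsilon f(x) = \mathrm{conv}\big(\bigcup_{y \in x + \epsilon B} \partial f(y)\big)$ is the Goldstein subdifferential, and the Goldstein subgradient $g_\epsilon(x)$ is its shortest vector. The Goldstein modulus is $\Gamma f(x) = \inf\{\epsilon \ge 0 : |g_\epsilon(x)| \le \epsilon\}$. Strong $C^2$ max function: $f$ is a strong $C^2$ max function at $\bar x$ if (a) $\bar x$ is Clarke critical and nondegenerate: $0$ lies in the relative interior of $\partial f(\bar x)$; (b) $f$ grows quadratically at $\bar x$: there is $\delta>0$ with $f(x) - f(\bar x) \ge \frac{\delta}{2}|x-\bar x|^2$ for all $x$ near $\bar x$; (c) for some finite set $I$ and $C^2$-smooth functions $f_i : X \to \mathbf{R}$ ($i \in I$), $f(x) = \max_{i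 \in I} f_i(x)$ for all $x$ near $\bar x$, and furthermore the values $f_i(\bar x)$ ($i\in I$) are all equal, and the gradients $\nabla f_i(\bar x)$ ($i \in I$) are affinely independent. In that case the active manifold $M$ is the set of those points $x \in X$ where the values $f_i(x)$ ($i \in I$) are all equal; it is a $C^2$-smooth manifold around $\bar x$. The function $f$ is subdifferentially regular at $x$ when $\lim_{t \downarrow 0} \frac1t (f(x+ty)-f(x)) = \max_{v \in \partial f(x)} \langle v,y\rangle$ for all $y \in X$. Robust growth: let a set $M \subset X$ be a $C^2$-smooth manifold around a point $\bar x \in M$; for $x$ near $\bar x$, $P_M(x)$ is the unique nearest point to $x$ in $M$ and $d_M(x)$ is the distance from $x$ to $M$. A locally Lipschitz function $f : X \to \mathbf{R}$ grows robustly relative to $M$ at $\bar x$ when the following properties hold: (1) $f$ grows quadratically at $\bar x$; (2) $f$ is subdifferentially regular throughout $M$; (3) the restriction $f_M : M \to \mathbf{R}$ is $C^2$-smooth; (4) the subdifferential $\partial f$ is upper Lipschitz relative to $M$ at $\bar x$: there is $K > 0$ such that all points $x,y$ near $\bar x$ with $x \in M$ satisfy $\partial f(y) \subset \partial f(x) + K|x-y|B$; (5) $f$ satisfies the aiming condition relative to $M$ at $\bar x$: there is $\mu > 0$ such that all $x \in X$ near $\bar x$ and all $v \in \partial f(x)$ satisfy $\langle v, x - P_M(x)\rangle \ge \mu\, d_M(x)$.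
   Formalization: Regularity "throughout M" and C²-smoothness of the restriction to M are proved only at points of M near x̄; over all of M they can fail, e.g. f = x² near 0 (a single piece f₁ = x², so M = R) but f = −|x−5| near 5. *)

theory Defs
  imports "HOL-Analysis.Analysis"
begin

section \<open>Smoothness and manifolds\<close>

definition locally_lipschitz :: "('a::metric_space \<Rightarrow> 'b::metric_space) \<Rightarrow> bool" where
  "locally_lipschitz f \<longleftrightarrow> (\<forall>x. \<exists>e>0. \<exists>L. L-lipschitz_on (ball x e) f)"

definition C2_on :: "'a::euclidean_space set \<Rightarrow> ('a \<Rightarrow> real) \<Rightarrow> bool" where
  "C2_on S f \<longleftrightarrow>
     (\<exists>(f' :: 'a \<Rightarrow> 'a \<Rightarrow>\<^sub>L real) (f'' :: 'a \<Rightarrow> 'a \<Rightarrow>\<^sub>L ('a \<Rightarrow>\<^sub>L real)).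
        (\<forall>x\<in>S. (f has_derivative blinfun_apply (f' x)) (at x)) \<and>
        (\<forall>x\<in>S. (f' has_derivative blinfun_apply (f'' x)) (at x)) \<and>
        continuous_on S f'')"

text \<open>Meaningful only where \<open>f\<close> is differentiable; there the gradient is unique.\<close>

definition gradient :: "('a::euclidean_space \<Rightarrow> real) \<Rightarrow> 'a \<Rightarrow> 'a" where
  "gradient f x = (THE D. GDERIV f x :> D)"

lemma gradient_eqI:
  assumes "GDERIV f x :> D"
  shows "gradient f x = D"
  unfolding gradient_def
proof (rule the_equality)
  show "GDERIV f x :> D" by (rule assms)
next
  fix E assume "GDERIV f x :> E"
  with assms have "(\<lambda>h. h \<bullet> E) = (\<lambda>h. h \<bullet> D)"
    unfolding gderiv_def by (metis has_derivative_unique)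
  then have "(E - D) \<bullet> E = (E - D) \<bullet> D"
    by (rule fun_cong)
  then have "(E - D) \<bullet> (E - D) = 0"
    by (simp add: inner_diff_right)
  then show "E = D"
    by simp
qed

text \<open>
  \<open>M\<close> is a \<open>C\<^sup>2\<close>-smooth manifold around \<open>x\<close>: near \<open>x\<close> it is the solution set of \<open>m\<close> equations
  \<open>h i = 0\<close> with \<open>C\<^sup>2\<close>-smooth left-hand sides whose gradients at \<open>x\<close> are linearly independent.
  Nothing is required of \<open>M\<close> away from \<open>x\<close>. The injectivity makes the independence that of
  the indexed family rather than of its range.
\<close>

definition C2_manifold_around :: "'a::euclidean_space set \<Rightarrow> 'a \<Rightarrow> bool" where
  "C2_manifold_around M x \<longleftrightarrow> x \<in> M \<and>
     (\<exists>U (m::nat) (h :: nat \<Rightarrow> 'a \<Rightarrow> real).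
        open U \<and> x \<in> U \<and> (\<forall>i<m. C2_on U (h i)) \<and>
        M \<inter> U = {y\<in>U. \<forall>i<m. h i y = 0} \<and>
        inj_on (\<lambda>i. gradient (h i) x) {..<m} \<and>
        independent ((\<lambda>i. gradient (h i) x) ` {..<m}))"

text \<open>
  A function on \<open>M\<close> is \<open>C\<^sup>2\<close>-smooth around \<open>x\<close> when it agrees on \<open>M\<close>, near \<open>x\<close>, with a
  \<open>C\<^sup>2\<close>-smooth function of the ambient space.
\<close>

definition C2_restriction_around :: "'a::euclidean_space set \<Rightarrow> ('a \<Rightarrow> real) \<Rightarrow> 'a \<Rightarrow> bool" where
  "C2_restriction_around M f x \<longleftrightarrow>
     (\<exists>U g. open U \<and> x \<in> U \<and> C2_on U g \<and> (\<forall>y\<in>M \<inter> U. f y = g y))"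


section \<open>Clarke and Goldstein subdifferentials\<close>

definition clarke_subdiff :: "('a::euclidean_space \<Rightarrow> real) \<Rightarrow> 'a \<Rightarrow> 'a set" where
  "clarke_subdiff f x =
     closure (convex hull
       {v. \<exists>X :: nat \<Rightarrow> 'a. X \<longlonglongrightarrow> x \<and> (\<forall>r. f differentiable (at (X r))) \<and>
             (\<lambda>r. gradient f (X r)) \<longlonglongrightarrow> v})"

definition clarke_critical :: "('a::euclidean_space \<Rightarrow> real) \<Rightarrow> 'a \<Rightarrow> bool" where
  "clarke_critical f x \<longleftrightarrow> 0 \<in> clarke_subdiff f x"

definition goldstein_subdiff :: "real \<Rightarrow> ('a::euclidean_space \<Rightarrow> real) \<Rightarrow> 'a \<Rightarrow> 'a set" where
  "goldstein_subdiff \<epsilon> f x = convex hull (\<Union>y\<in>cball x \<epsilon>. clarke_subdiff f y)"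

text \<open>
  For locally Lipschitz \<open>f\<close> and \<open>\<epsilon> \<ge> 0\<close> the Goldstein subdifferential is nonempty, compact and
  convex, so it has exactly one shortest vector.
\<close>

definition goldstein_subgradient :: "real \<Rightarrow> ('a::euclidean_space \<Rightarrow> real) \<Rightarrow> 'a \<Rightarrow> 'a" where
  "goldstein_subgradient \<epsilon> f x = closest_point (goldstein_subdiff \<epsilon> f x) 0"

definition goldstein_modulus :: "('a::euclidean_space \<Rightarrow> real) \<Rightarrow> 'a \<Rightarrow> real" where
  "goldstein_modulus f x = Inf {\<epsilon>. \<epsilon> \<ge> 0 \<and> norm (goldstein_subgradient \<epsilon> f x) \<le> \<epsilon>}"

text \<open>
  For locally Lipschitz \<open>f\<close> the Clarke subdifferential is nonempty and compact, so the
  supremum is a maximum.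
\<close>

definition subdiff_regular :: "('a::euclidean_space \<Rightarrow> real) \<Rightarrow> 'a \<Rightarrow> bool" where
  "subdiff_regular f x \<longleftrightarrow>
     (\<forall>y. ((\<lambda>t. (f (x + t *\<^sub>R y) - f x) / t) \<longlongrightarrow> (SUP v\<in>clarke_subdiff f x. v \<bullet> y)) (at_right 0))"


section \<open>Strong max functions and robust growth\<close>

definition grows_quadratically :: "('a::euclidean_space \<Rightarrow> real) \<Rightarrow> 'a \<Rightarrow> bool" where
  "grows_quadratically f xb \<longleftrightarrow>
     (\<exists>\<delta>>0. \<forall>\<^sub>F x in nhds xb. f x - f xb \<ge> \<delta> / 2 * (norm (x - xb))\<^sup>2)"

text \<open>
  The representing family \<open>(\<phi> i)\<close>, \<open>i \<in> I\<close>, is a parameter because the active manifold depends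
  on it. As for linear independence above, affine independence is that of the indexed family.
\<close>

definition strong_C2_max ::
    "('a::euclidean_space \<Rightarrow> real) \<Rightarrow> 'i set \<Rightarrow> ('i \<Rightarrow> 'a \<Rightarrow> real) \<Rightarrow> 'a \<Rightarrow> bool" where
  "strong_C2_max f I \<phi> xb \<longleftrightarrow>
     clarke_critical f xb \<and> 0 \<in> rel_interior (clarke_subdiff f xb) \<and>
     grows_quadratically f xb \<and>
     finite I \<and> I \<noteq> {} \<and> (\<forall>i\<in>I. C2_on UNIV (\<phi> i)) \<and>
     (\<forall>\<^sub>F x in nhds xb. f x = Max ((\<lambda>i. \<phi> i x) ` I)) \<and>
     (\<forall>i\<in>I. \<forall>j\<in>I. \<phi> i xb = \<phi> j xb) \<and>
     inj_on (\<lambda>i. gradient (\<phi> i) xb) I \<and>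
     \<not> affine_dependent ((\<lambda>i. gradient (\<phi> i) xb) ` I)"

definition active_manifold :: "'i set \<Rightarrow> ('i \<Rightarrow> 'a::euclidean_space \<Rightarrow> real) \<Rightarrow> 'a set" where
  "active_manifold I \<phi> = {x. \<forall>i\<in>I. \<forall>j\<in>I. \<phi> i x = \<phi> j x}"

definition upper_lipschitz_subdiff ::
    "('a::euclidean_space \<Rightarrow> real) \<Rightarrow> 'a set \<Rightarrow> 'a \<Rightarrow> bool" where
  "upper_lipschitz_subdiff f M xb \<longleftrightarrow>
     (\<exists>K>0. \<exists>e>0. \<forall>x\<in>M \<inter> ball xb e. \<forall>y\<in>ball xb e.
        clarke_subdiff f y \<subseteq>
          {v + (K * norm (x - y)) *\<^sub>R b | v b. v \<in> clarke_subdiff f x \<and> b \<in> cball 0 1})"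

text \<open>
  \<open>closest_point M x\<close> is the projection \<open>P\<^sub>M(x)\<close>: around a point where \<open>M\<close> is a
  \<open>C\<^sup>2\<close>-smooth manifold the nearest point exists and is unique.
\<close>

definition aiming_condition :: "('a::euclidean_space \<Rightarrow> real) \<Rightarrow> 'a set \<Rightarrow> 'a \<Rightarrow> bool" where
  "aiming_condition f M xb \<longleftrightarrow>
     (\<exists>\<mu>>0. \<forall>\<^sub>F x in nhds xb. \<forall>v\<in>clarke_subdiff f x.
        v \<bullet> (x - closest_point M x) \<ge> \<mu> * infdist x M)"

text \<open>
  Only the part of \<open>M\<close> near \<open>xb\<close> matters: \<open>M\<close> is a manifold only there, so regularity
  throughout \<open>M\<close> and smoothness of the restriction to \<open>M\<close> are required around \<open>xb\<close>. Over a
  whole active manifold they can fail, since a strong max function is constrained only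
  near \<open>xb\<close>.
\<close>

definition grows_robustly :: "('a::euclidean_space \<Rightarrow> real) \<Rightarrow> 'a set \<Rightarrow> 'a \<Rightarrow> bool" where
  "grows_robustly f M xb \<longleftrightarrow>
     locally_lipschitz f \<and> C2_manifold_around M xb \<and>
     grows_quadratically f xb \<and>
     (\<forall>\<^sub>F x in nhds xb. x \<in> M \<longrightarrow> subdiff_regular f x) \<and>
     C2_restriction_around M f xb \<and>
     upper_lipschitz_subdiff f M xb \<and>
     aiming_condition f M xb"

end

theory Submission
  imports Defs
begin

text \<open>
  Near \<open>xb\<close> the Clarke subdifferential is the convex hull of the gradients of the active
  \<open>\<phi> i\<close>: affine independence provides, for each \<open>i\<close>, a direction \<open>W i\<close> along which \<open>\<phi> i\<close>
  alone becomes active. The same directions show that \<open>f\<close> decreases at a definite rate off the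
  manifold, so \<open>f x - f p \<ge> \<mu> \<bar>x - p\<bar>\<close> for the projection \<open>p\<close> of \<open>x\<close>; this is the aiming
  condition. On the manifold, comparing a convex combination of gradients with the multipliers
  \<open>lam\<close> of the critical point \<open>xb\<close> turns quadratic growth of values into linear growth of
  gradients. For the Goldstein modulus at radius \<open>\<epsilon>\<close>, either \<open>x\<close> is farther from the manifold
  than a multiple of \<open>\<epsilon>\<close> and aiming bounds all nearby subgradients from below along \<open>x - p\<close>,
  or each of them lies within a multiple of \<open>\<epsilon>\<close> of the hull of the gradients at \<open>p\<close>, whose
  elements have norm at least a multiple of \<open>\<bar>p - xb\<bar>\<close>.
\<close>

section \<open>Convex hulls and gradients\<close>

text \<open>No chart or tangent space of the manifold is used. In their place stands the sum of the
  \<open>lam i * \<phi> i\<close>: it is smooth on the whole space, equals \<open>f\<close> on the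
  manifold near \<open>xb\<close>, and has zero gradient at \<open>xb\<close>. The decrease off the
  manifold only produces some point \<open>z\<close> of the manifold with \<open>f x - f z\<close>
  at least a multiple of the distance from \<open>x\<close> to \<open>z\<close>. To pass from
  \<open>z\<close> to the nearest point \<open>p\<close>, note that near \<open>xb\<close> the
  weighted sum has an arbitrarily small Lipschitz constant, so \<open>f z\<close> and
  \<open>f p\<close> differ by a small fraction of the distance from \<open>z\<close> to
  \<open>p\<close>. Values turn into subgradients by Taylor expansion: every \<open>\<phi> i\<close>
  equals \<open>f\<close> at \<open>p\<close>, so for active \<open>i\<close> the inner product of
  the gradient with \<open>x - p\<close> is \<open>f x - f p\<close> up to a quadratic error. For
  the Goldstein subdifferential this is proved with the gradient taken at a nearby \<open>y\<close>
  but the direction \<open>x - p\<close> kept, so that one half-space contains all the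
  subdifferentials in the union and hence their hull.\<close>

lemma ex_uniform_radius:
  fixes P :: "'i \<Rightarrow> real \<Rightarrow> bool"
  assumes "finite I"
    and "\<And>i. i \<in> I \<Longrightarrow> \<exists>e>0. P i e"
    and anti: "\<And>i e e'. P i e \<Longrightarrow> 0 < e' \<Longrightarrow> e' \<le> e \<Longrightarrow> P i e'"
  shows "\<exists>e>0. \<forall>i\<in>I. P i e"
  using assms(1,2)
proof (induction I rule: finite_induct)
  case empty
  show ?case by (auto intro: exI[of _ 1])
next
  case (insert j J)
  then obtain e1 e2 where "e1 > 0" "P j e1" "e2 > 0" "\<forall>i\<in>J. P i e2" by force
  then have "min e1 e2 > 0" "\<forall>i\<in>insert j J. P i (min e1 e2)"
    using anti[of _ e1 "min e1 e2"] anti[of _ e2 "min e1 e2"] by auto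
  then show ?case by blast
qed

text \<open>The weights belong to indices, not to points: \<open>g\<close> need not be injective,
  and weights found for the gradients at one point can be reused at another.\<close>

lemma convex_hull_image_finite:
  fixes g :: "'i \<Rightarrow> 'a::real_vector"
  assumes "finite A"
  shows "convex hull (g ` A) = {\<Sum>i\<in>A. u i *\<^sub>R g i | u. (\<forall>i\<in>A. 0 \<le> u i) \<and> sum u A = 1}"
    (is "_ = ?R")
proof
  show "convex hull (g ` A) \<subseteq> ?R"
  proof (rule hull_minimal)
    show "g ` A \<subseteq> ?R"
    proof
      fix v assume "v \<in> g ` A"
      then obtain i where i: "i \<in> A" "v = g i" by auto
      have "(\<Sum>j\<in>A. (if j = i then 1 else 0) *\<^sub>R g j) = (\<Sum>j\<in>A. if j = i then g j else 0)"
        by (intro sum.cong) auto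
      then show "v \<in> ?R"
        using i assms by (intro CollectI exI[of _ "\<lambda>j. if j = i then 1 else 0"]) auto
    qed
    show "convex ?R"
    proof (rule convexI)
      fix x y and a b :: real
      assume "x \<in> ?R" "y \<in> ?R" and ab: "0 \<le> a" "0 \<le> b" "a + b = 1"
      then obtain u w where u: "x = (\<Sum>i\<in>A. u i *\<^sub>R g i)" "\<forall>i\<in>A. 0 \<le> u i" "sum u A = 1"
        and w: "y = (\<Sum>i\<in>A. w i *\<^sub>R g i)" "\<forall>i\<in>A. 0 \<le> w i" "sum w A = 1" by blast
      have "a *\<^sub>R x + b *\<^sub>R y = (\<Sum>i\<in>A. (a * u i + b * w i) *\<^sub>R g i)"
        by (simp add: u w scaleR_sum_right sum.distrib scaleR_add_left)
      moreover have "(\<Sum>i\<in>A. a * u i + b * w i) = 1"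
        using u w ab by (simp add: sum.distrib flip: sum_distrib_left)
      ultimately show "a *\<^sub>R x + b *\<^sub>R y \<in> ?R"
        using u w ab by (intro CollectI exI[of _ "\<lambda>i. a * u i + b * w i"]) auto
    qed
  qed
  show "?R \<subseteq> convex hull (g ` A)"
    using assms by (fastforce intro: convex_sum[OF _ convex_convex_hull] hull_inc)
qed

section \<open>Gradients of C2 functions\<close>

text \<open>Riesz representation in coordinates. \<open>gradient\<close> is a definite description;
  existence comes from here, uniqueness from \<open>gradient_eqI\<close>.\<close>

lemma gradient_inner_eq:
  fixes f :: "'a::euclidean_space \<Rightarrow> real"
  assumes "(f has_derivative F) (at x)"
  shows "GDERIV f x :> gradient f x" "gradient f x \<bullet> h = F h" "h \<bullet> gradient f x = F h"
proof -
  interpret F: linear F using assms has_derivative_linear by blast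
  define D where "D = (\<Sum>b\<in>Basis. F b *\<^sub>R b)"
  have D: "h \<bullet> D = F h" for h
  proof -
    have "F h = F (\<Sum>b\<in>Basis. (h \<bullet> b) *\<^sub>R b)" by (simp add: euclidean_representation)
    then show ?thesis by (simp add: D_def F.sum F.scale inner_sum_right mult.commute)
  qed
  then have "GDERIV f x :> D" using assms by (simp add: gderiv_def D)
  then show "GDERIV f x :> gradient f x" "gradient f x \<bullet> h = F h" "h \<bullet> gradient f x = F h"
    using gradient_eqI[of f x D] D by (auto simp: inner_commute)
qed

text \<open>By continuity the second derivative is bounded near \<open>x\<close>, so the mean value
  inequality makes \<open>f'\<close> Lipschitz there.\<close>

lemma C2_on_gradient_lipschitz:
  fixes f :: "'a::euclidean_space \<Rightarrow> real"
  assumes "C2_on S f" "open S" "x \<in> S"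
  shows "\<exists>e>0. \<exists>L. \<forall>y\<in>ball x e. \<forall>z\<in>ball x e. norm (gradient f y - gradient f z) \<le> L * norm (y - z)"
proof -
  obtain f' :: "'a \<Rightarrow> 'a \<Rightarrow>\<^sub>L real" and f'' :: "'a \<Rightarrow> 'a \<Rightarrow>\<^sub>L ('a \<Rightarrow>\<^sub>L real)"
    where f': "\<And>x. x \<in> S \<Longrightarrow> (f has_derivative blinfun_apply (f' x)) (at x)"
      and f'': "\<And>x. x \<in> S \<Longrightarrow> (f' has_derivative blinfun_apply (f'' x)) (at x)"
      and cont: "continuous_on S f''"
    using assms(1) unfolding C2_on_def by metis
  have "isCont f'' x" using cont assms continuous_on_eq_continuous_at by blast
  then have "(\<lambda>y. norm (f'' y)) \<midarrow>x\<rightarrow> norm (f'' x)" by (simp add: isCont_def tendsto_norm)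
  then have "\<forall>\<^sub>F y in at x. norm (f'' y) < norm (f'' x) + 1"
    by (rule order_tendstoD) simp
  then obtain d where d: "d > 0" "\<And>y. y \<noteq> x \<Longrightarrow> dist y x < d \<Longrightarrow> norm (f'' y) < norm (f'' x) + 1"
    unfolding eventually_at by auto
  obtain c where c: "c > 0" "ball x c \<subseteq> S" using assms openE by blast
  define e where "e = min c d"
  have e: "e > 0" "ball x e \<subseteq> S" using c d by (auto simp: e_def)
  have lip: "norm (f' y - f' z) \<le> (norm (f'' x) + 1) * norm (y - z)"
    if "y \<in> ball x e" "z \<in> ball x e" for y z
  proof (rule differentiable_bound[OF convex_ball _ _ that])
    fix w assume w: "w \<in> ball x e"
    then show "(f' has_derivative blinfun_apply (f'' w)) (at w within ball x e)"
      using e f'' has_derivative_at_withinI by blast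
    have "norm (f'' w) \<le> norm (f'' x) + 1"
      using d(2)[of w] w by (cases "w = x") (auto simp: e_def dist_commute)
    then show "onorm (blinfun_apply (f'' w)) \<le> norm (f'' x) + 1" by (simp add: norm_blinfun.rep_eq)
  qed
  have "norm (gradient f y - gradient f z) \<le> (norm (f'' x) + 1) * norm (y - z)"
    if "y \<in> ball x e" "z \<in> ball x e" for y z
  proof -
    \<comment> \<open>Testing the difference of derivatives on \<open>D\<close> itself gives the
      squared norm of \<open>D\<close>, so the operator norm bounds it.\<close>
    define D where "D = gradient f y - gradient f z"
    have yz: "y \<in> S" "z \<in> S" using that e by auto
    have "D \<bullet> D = blinfun_apply (f' y - f' z) D"
      using gradient_inner_eq(2)[OF f'[OF yz(1)], of D] gradient_inner_eq(2)[OF f'[OF yz(2)], of D]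
      by (subst (1) D_def) (simp add: inner_diff_left blinfun.diff_left)
    also have "\<dots> \<le> norm (f' y - f' z) * norm D"
      using norm_blinfun[of "f' y - f' z" D] by simp
    finally have "norm D * norm D \<le> norm (f' y - f' z) * norm D"
      by (simp add: power2_norm_eq_inner flip: power2_eq_square)
    then have "norm D \<le> norm (f' y - f' z)" by (cases "D = 0") auto
    then show ?thesis using lip[OF that] by (simp add: D_def)
  qed
  then show ?thesis using e by blast
qed

text \<open>The trapezoidal rule for the integral of the derivative along the segment from \<open>x\<close> to \<open>y\<close>:
  only differentiability of the gradient at \<open>x\<close> is needed, and the Hessian cancels.\<close>

lemma C2_on_trapezoid:
  fixes f :: "'a::euclidean_space \<Rightarrow> real"
  assumes "C2_on S f" "open S" "x \<in> S" "\<eta> > 0"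
  shows "\<exists>e>0. \<forall>y\<in>ball x e.
    \<bar>2 * (f y - f x) - (gradient f y + gradient f x) \<bullet> (y - x)\<bar> \<le> \<eta> * (norm (y - x))\<^sup>2"
proof -
  obtain f' :: "'a \<Rightarrow> 'a \<Rightarrow>\<^sub>L real" and f'' :: "'a \<Rightarrow> 'a \<Rightarrow>\<^sub>L ('a \<Rightarrow>\<^sub>L real)"
    where f': "\<And>x. x \<in> S \<Longrightarrow> (f has_derivative blinfun_apply (f' x)) (at x)"
      and f'': "\<And>x. x \<in> S \<Longrightarrow> (f' has_derivative blinfun_apply (f'' x)) (at x)"
    using assms(1) unfolding C2_on_def by metis
  \<comment> \<open>The closing identity leaves \<open>2 * R t - R 1\<close>, three remainders in
    all.\<close>
  have "\<eta> / 3 > 0" using assms(4) by simp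
  with f''[OF assms(3)] obtain d where d: "d > 0"
    "\<And>y. norm (y - x) < d \<Longrightarrow> norm (f' y - f' x - f'' x (y - x)) \<le> \<eta> / 3 * norm (y - x)"
    unfolding has_derivative_at_alt by blast
  obtain c where c: "c > 0" "ball x c \<subseteq> S" using assms openE by blast
  define e where "e = min c d"
  have e: "e > 0" "ball x e \<subseteq> S" using c d by (auto simp: e_def)
  have "\<bar>2 * (f y - f x) - (gradient f y + gradient f x) \<bullet> (y - x)\<bar> \<le> \<eta> * (norm (y - x))\<^sup>2"
    if y: "y \<in> ball x e" for y
  proof -
    define q where "q = y - x"
    have q: "norm q < e" using y by (simp add: q_def dist_norm norm_minus_commute)
    define R where "R t = f' (x + t *\<^sub>R q) q - f' x q - t * f'' x q q" for t
    have R: "\<bar>R t\<bar> \<le> \<eta> / 3 * (norm q)\<^sup>2" and inS: "x + t *\<^sub>R q \<in> S" if t: "0 \<le> t" "t \<le> 1" for t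
    proof -
      have tq: "norm (t *\<^sub>R q) \<le> norm q" using t by (simp add: mult_left_le_one_le)
      then have "norm (t *\<^sub>R q) < e" using q by linarith
      then show "x + t *\<^sub>R q \<in> S" using e by (auto simp: dist_norm)
      have "R t = (f' (x + t *\<^sub>R q) - f' x - f'' x (t *\<^sub>R q)) q"
        by (simp add: R_def blinfun.diff_left blinfun.scaleR_left blinfun.scaleR_right)
      also have "\<bar>\<dots>\<bar> \<le> norm (f' (x + t *\<^sub>R q) - f' x - f'' x (t *\<^sub>R q)) * norm q"
        using norm_blinfun by (metis real_norm_def)
      also have "\<dots> \<le> (\<eta> / 3 * norm (t *\<^sub>R q)) * norm q"
        using d(2)[of "x + t *\<^sub>R q"] \<open>norm (t *\<^sub>R q) < e\<close> by (intro mult_right_mono) (auto simp: e_def)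
      also have "\<dots> \<le> (\<eta> / 3 * norm q) * norm q"
        using tq assms(4) by (intro mult_right_mono mult_left_mono) auto
      finally show "\<bar>R t\<bar> \<le> \<eta> / 3 * (norm q)\<^sup>2" by (simp add: power2_eq_square)
    qed
    \<comment> \<open>\<open>f\<close> on the segment minus the first and second order terms at
      \<open>x\<close>, so that the derivative of \<open>\<zeta>\<close> is
      \<open>R\<close>.\<close>
    define \<zeta> where "\<zeta> t = f (x + t *\<^sub>R q) - t * f' x q - t\<^sup>2 / 2 * f'' x q q" for t
    have "\<exists>t\<in>{0..1}. \<zeta> 1 - \<zeta> 0 = (\<lambda>h. h * R t) (1 - 0)"
    proof (rule mvt_very_simple)
      fix t :: real assume t: "0 \<le> t" "t \<le> 1"
      have "((\<lambda>t. f (x + t *\<^sub>R q)) has_derivative (\<lambda>h. f' (x + t *\<^sub>R q) (h *\<^sub>R q))) (at t within {0..1})"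
        by (rule has_derivative_compose[of "\<lambda>t. x + t *\<^sub>R q" _ _ _ f])
          (auto intro!: derivative_eq_intros f' inS t)
      then show "(\<zeta> has_derivative (\<lambda>h. h * R t)) (at t within {0..1})"
        unfolding \<zeta>_def R_def
        by (auto intro!: derivative_eq_intros simp: algebra_simps blinfun.scaleR_right power2_eq_square)
    qed simp
    then obtain t where t: "0 \<le> t" "t \<le> 1" "\<zeta> 1 - \<zeta> 0 = R t" by auto
    have "\<zeta> 1 - \<zeta> 0 = f y - f x - f' x q - f'' x q q / 2" by (simp add: \<zeta>_def q_def)
    moreover have "R 1 = f' y q - f' x q - f'' x q q" by (simp add: R_def q_def)
    moreover have "(gradient f y + gradient f x) \<bullet> (y - x) = f' y q + f' x q"
      using gradient_inner_eq(2)[OF f'] y e assms(3) by (force simp: inner_add_left q_def)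
    \<comment> \<open>The Hessian enters \<open>2 * (\<zeta> 1 - \<zeta> 0)\<close> and
      \<open>R 1\<close> with the same coefficient and cancels.\<close>
    ultimately have "2 * (f y - f x) - (gradient f y + gradient f x) \<bullet> (y - x) = 2 * R t - R 1"
      using t(3) by (simp add: algebra_simps)
    then show ?thesis using R[OF t(1,2)] R[of 1] unfolding q_def[symmetric] by linarith
  qed
  then show ?thesis using e by blast
qed

text \<open>\<open>w i\<close> represents the linear part of the \<open>i\<close>-th barycentric
  coordinate. The vectors \<open>g j - g i\<close> with \<open>j\<close> other than \<open>i\<close>
  are linearly independent, so some linear functional equals -1 on all of them.\<close>

lemma affine_independent_dual_vectors:
  fixes g :: "'i \<Rightarrow> 'a::euclidean_space"
  assumes "finite I" "inj_on g I" "\<not> affine_dependent (g ` I)"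
  shows "\<exists>w. \<forall>i\<in>I. \<forall>j\<in>I. \<forall>k\<in>I. (g j - g k) \<bullet> w i = (if i = j then 1 else 0) - (if i = k then 1 else 0)"
proof -
  have "\<exists>w. \<forall>j\<in>I. \<forall>k\<in>I. (g j - g k) \<bullet> w = (if i = j then 1 else 0) - (if i = k then 1 else 0)"
    if i: "i \<in> I" for i
  proof -
    let ?B = "(\<lambda>x. - g i + x) ` (g ` I - {g i})"
    have "independent ?B"
      using affine_dependent_iff_dependent2[of "g i" "g ` I"] assms(3) i by auto
    then obtain h where h: "linear h" "\<And>x. x \<in> ?B \<Longrightarrow> h x = (-1 :: real)"
      using linear_independent_extend[of ?B "\<lambda>_. -1"] by blast
    have hw: "x \<bullet> gradient h 0 = h x" for x
      using gradient_inner_eq(3)[of h h 0] linear_imp_has_derivative[OF h(1)] by blast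
    have val: "(g j - g i) \<bullet> gradient h 0 = (if i = j then 0 else - 1)" if j: "j \<in> I" for j
    proof (cases "i = j")
      case False
      then have "g j \<noteq> g i" using assms(2) i j by (auto simp: inj_on_def)
      then have "g j - g i \<in> ?B" using j by (auto simp: image_iff intro!: bexI[of _ "g j"])
      then show ?thesis using False h hw by simp
    qed simp
    show ?thesis
    proof (intro exI ballI)
      fix j k assume "j \<in> I" "k \<in> I"
      have "(g j - g k) \<bullet> gradient h 0 = (g j - g i) \<bullet> gradient h 0 - (g k - g i) \<bullet> gradient h 0"
        by (simp add: inner_diff_left)
      then show "(g j - g k) \<bullet> gradient h 0 = (if i = j then 1 else 0) - (if i = k then 1 else 0)"
        using val[OF \<open>j \<in> I\<close>] val[OF \<open>k \<in> I\<close>] by auto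
    qed
  qed
  then show ?thesis by metis
qed

lemma tendsto_Max_image:
  fixes g :: "'i \<Rightarrow> 'b \<Rightarrow> real"
  assumes "finite I" "I \<noteq> {}" "\<And>i. i \<in> I \<Longrightarrow> (g i \<longlongrightarrow> l i) F"
  shows "((\<lambda>t. Max ((\<lambda>i. g i t) ` I)) \<longlongrightarrow> Max (l ` I)) F"
  using assms
  by (induction I rule: finite_ne_induct) (auto intro!: tendsto_max)

lemma infdist_eq_closest_point:
  assumes "closed S" "S \<noteq> {}"
  shows "infdist x S = dist x (closest_point S x)"
proof (rule antisym)
  show "infdist x S \<le> dist x (closest_point S x)"
    by (simp add: assms closest_point_in_set infdist_le)
  obtain y where "y \<in> S" "infdist x S = dist x y" using infdist_attains_inf[OF assms] by blast
  then show "dist x (closest_point S x) \<le> infdist x S"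
    by (simp add: assms closest_point_le)
qed

lemma C2_on_GDERIV:
  assumes "C2_on S f" "x \<in> S"
  shows "GDERIV f x :> gradient f x"
  using assms gradient_inner_eq(1) unfolding C2_on_def by blast

lemma C2_on_subset:
  assumes "C2_on S f" "T \<subseteq> S"
  shows "C2_on T f"
  using assms continuous_on_subset unfolding C2_on_def by blast

lemma C2_on_diff:
  assumes "C2_on S f" "C2_on S g"
  shows "C2_on S (\<lambda>x. f x - g x)"
proof -
  obtain f' f'' where f: "\<And>x. x \<in> S \<Longrightarrow> (f has_derivative blinfun_apply (f' x)) (at x)"
      "\<And>x. x \<in> S \<Longrightarrow> (f' has_derivative blinfun_apply (f'' x)) (at x)" "continuous_on S f''"
    using assms(1) unfolding C2_on_def by blast
  obtain g' g'' where g: "\<And>x. x \<in> S \<Longrightarrow> (g has_derivative blinfun_apply (g' x)) (at x)"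
      "\<And>x. x \<in> S \<Longrightarrow> (g' has_derivative blinfun_apply (g'' x)) (at x)" "continuous_on S g''"
    using assms(2) unfolding C2_on_def by blast
  show ?thesis unfolding C2_on_def
  proof (intro exI[of _ "\<lambda>x. f' x - g' x"] exI[of _ "\<lambda>x. f'' x - g'' x"] conjI ballI)
    fix x assume x: "x \<in> S"
    show "((\<lambda>x. f x - g x) has_derivative blinfun_apply (f' x - g' x)) (at x)"
      using has_derivative_diff[OF f(1)[OF x] g(1)[OF x]] by (simp add: blinfun.diff_left[abs_def])
    show "((\<lambda>x. f' x - g' x) has_derivative blinfun_apply (f'' x - g'' x)) (at x)"
      using has_derivative_diff[OF f(2)[OF x] g(2)[OF x]] by (simp add: blinfun.diff_left[abs_def])
  next
    show "continuous_on S (\<lambda>x. f'' x - g'' x)" using f(3) g(3) by (rule continuous_on_diff)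
  qed
qed

lemma locally_lipschitz_continuous:
  assumes "locally_lipschitz f"
  shows "continuous_on UNIV f"
proof (intro continuous_at_imp_continuous_on ballI)
  fix x
  obtain e L where "e > 0" "L-lipschitz_on (ball x e) f"
    using assms unfolding locally_lipschitz_def by blast
  then show "isCont f x"
    using lipschitz_on_continuous_on continuous_on_eq_continuous_at open_ball centre_in_ball by blast
qed

lemma C2_family_uniform_lipschitz:
  fixes \<phi> :: "'i \<Rightarrow> 'a::euclidean_space \<Rightarrow> real"
  assumes "finite I" "\<And>i. i \<in> I \<Longrightarrow> C2_on UNIV (\<phi> i)"
  shows "\<exists>e>0. \<exists>L\<ge>0. \<forall>i\<in>I. \<forall>y\<in>ball x e. \<forall>z\<in>ball x e.
    norm (gradient (\<phi> i) y - gradient (\<phi> i) z) \<le> L * norm (y - z)"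
proof -
  have "\<exists>e>0. \<forall>i\<in>I. \<exists>L. \<forall>y\<in>ball x e. \<forall>z\<in>ball x e.
      norm (gradient (\<phi> i) y - gradient (\<phi> i) z) \<le> L * norm (y - z)"
  proof (rule ex_uniform_radius[OF assms(1)])
    show "\<exists>e>0. \<exists>L. \<forall>y\<in>ball x e. \<forall>z\<in>ball x e.
        norm (gradient (\<phi> i) y - gradient (\<phi> i) z) \<le> L * norm (y - z)" if "i \<in> I" for i
      using C2_on_gradient_lipschitz[OF assms(2)[OF that] open_UNIV UNIV_I] .
  next
    fix i and e e' :: real
    assume "\<exists>L. \<forall>y\<in>ball x e. \<forall>z\<in>ball x e. norm (gradient (\<phi> i) y - gradient (\<phi> i) z) \<le> L * norm (y - z)"
      "0 < e'" "e' \<le> e"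
    then show "\<exists>L. \<forall>y\<in>ball x e'. \<forall>z\<in>ball x e'. norm (gradient (\<phi> i) y - gradient (\<phi> i) z) \<le> L * norm (y - z)"
      by (meson subset_ball subsetD)
  qed
  then obtain e l where e: "e > 0" "\<And>i y z. i \<in> I \<Longrightarrow> y \<in> ball x e \<Longrightarrow> z \<in> ball x e \<Longrightarrow>
      norm (gradient (\<phi> i) y - gradient (\<phi> i) z) \<le> l i * norm (y - z)" by metis
  have "norm (gradient (\<phi> i) y - gradient (\<phi> i) z) \<le> (\<Sum>i\<in>I. \<bar>l i\<bar>) * norm (y - z)"
    if "i \<in> I" "y \<in> ball x e" "z \<in> ball x e" for i y z
  proof -
    have "l i \<le> (\<Sum>i\<in>I. \<bar>l i\<bar>)"
      using member_le_sum[OF that(1), of "\<lambda>i. \<bar>l i\<bar>"] assms(1) by simp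
    then show ?thesis using e(2)[OF that] by (meson mult_right_mono norm_ge_zero order_trans)
  qed
  moreover have "(\<Sum>i\<in>I. \<bar>l i\<bar>) \<ge> 0" by (intro sum_nonneg) auto
  ultimately show ?thesis using e(1) by blast
qed

lemma C2_family_uniform_trapezoid:
  fixes \<phi> :: "'i \<Rightarrow> 'a::euclidean_space \<Rightarrow> real"
  assumes "finite I" "\<And>i. i \<in> I \<Longrightarrow> C2_on UNIV (\<phi> i)" "\<eta> > 0"
  shows "\<exists>e>0. \<forall>i\<in>I. \<forall>y\<in>ball x e.
    \<bar>2 * (\<phi> i y - \<phi> i x) - (gradient (\<phi> i) y + gradient (\<phi> i) x) \<bullet> (y - x)\<bar> \<le> \<eta> * (norm (y - x))\<^sup>2"
proof (rule ex_uniform_radius[OF assms(1)])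
  fix i assume "i \<in> I"
  then show "\<exists>e>0. \<forall>y\<in>ball x e.
      \<bar>2 * (\<phi> i y - \<phi> i x) - (gradient (\<phi> i) y + gradient (\<phi> i) x) \<bullet> (y - x)\<bar> \<le> \<eta> * (norm (y - x))\<^sup>2"
    using C2_on_trapezoid[OF assms(2) open_UNIV UNIV_I assms(3)] by blast
qed auto

text \<open>The defining equations are the differences from one reference function
  \<open>\<phi> a\<close>; affine independence of the gradients is linear independence of the
  gradients of these differences. A singleton \<open>I\<close> gives no equation and the whole
  space.\<close>

lemma active_manifold_C2:
  fixes \<phi> :: "'i \<Rightarrow> 'a::euclidean_space \<Rightarrow> real"
  assumes "finite I" "I \<noteq> {}" and C2: "\<And>i. i \<in> I \<Longrightarrow> C2_on UNIV (\<phi> i)"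
    and mem: "x \<in> active_manifold I \<phi>"
    and inj: "inj_on (\<lambda>i. gradient (\<phi> i) x) I"
    and indep: "\<not> affine_dependent ((\<lambda>i. gradient (\<phi> i) x) ` I)"
  shows "C2_manifold_around (active_manifold I \<phi>) x"
proof -
  obtain a where a: "a \<in> I" using assms(2) by blast
  obtain k :: "nat \<Rightarrow> 'i" where "bij_betw k {0..<card (I - {a})} (I - {a})"
    using ex_bij_betw_nat_finite[of "I - {a}"] assms(1) by blast
  then have k: "inj_on k {..<card (I - {a})}" "k ` {..<card (I - {a})} = I - {a}"
    by (auto simp: bij_betw_def atLeast0LessThan)
  define m where "m = card (I - {a})"
  define h where "h n y = \<phi> (k n) y - \<phi> a y" for n y
  have kI: "k n \<in> I" if "n < m" for n using k(2) that by (auto simp: m_def)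
  have grad: "gradient (h n) x = gradient (\<phi> (k n)) x - gradient (\<phi> a) x" if n: "n < m" for n
  proof (rule gradient_eqI)
    have "GDERIV (\<phi> (k n)) x :> gradient (\<phi> (k n)) x" "GDERIV (\<phi> a) x :> gradient (\<phi> a) x"
      using C2_on_GDERIV C2 kI[OF n] a by blast+
    then show "GDERIV (h n) x :> gradient (\<phi> (k n)) x - gradient (\<phi> a) x"
      unfolding h_def[abs_def] by (rule GDERIV_diff)
  qed
  let ?g = "\<lambda>i. gradient (\<phi> i) x"
  have img: "(\<lambda>n. gradient (h n) x) ` {..<m} = (\<lambda>y. - ?g a + y) ` (?g ` I - {?g a})"
  proof -
    have "(\<lambda>n. gradient (h n) x) ` {..<m} = (\<lambda>i. - ?g a + ?g i) ` k ` {..<m}"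
      unfolding image_image using grad by (intro image_cong) auto
    also have "\<dots> = (\<lambda>y. - ?g a + y) ` ?g ` (I - {a})" using k(2) by (simp add: m_def image_image)
    also have "?g ` (I - {a}) = ?g ` I - {?g a}" using inj a by (auto simp: inj_on_def)
    finally show ?thesis .
  qed
  have "inj_on (\<lambda>n. gradient (h n) x) {..<m}"
  proof (rule inj_onI)
    fix n n' assume n: "n \<in> {..<m}" "n' \<in> {..<m}" "gradient (h n) x = gradient (h n') x"
    then have "k n = k n'" using grad inj kI by (auto dest: inj_onD)
    then show "n = n'" using k(1) n by (auto simp: m_def dest: inj_onD)
  qed
  moreover have "independent ((\<lambda>n. gradient (h n) x) ` {..<m})"
    unfolding img using affine_dependent_iff_dependent2[of "?g a" "?g ` I"] a indep by blast
  moreover have "active_manifold I \<phi> = {y. \<forall>n<m. h n y = 0}"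
  proof -
    have "(\<forall>n<m. h n y = 0) \<longleftrightarrow> (\<forall>i\<in>k ` {..<m}. \<phi> i y = \<phi> a y)" for y
      by (auto simp: h_def)
    also have "\<dots> y \<longleftrightarrow> (\<forall>i\<in>I. \<phi> i y = \<phi> a y)" for y using k(2) by (auto simp: m_def)
    also have "\<dots> y \<longleftrightarrow> (\<forall>i\<in>I. \<forall>j\<in>I. \<phi> i y = \<phi> j y)" for y using a by metis
    finally show ?thesis unfolding active_manifold_def by blast
  qed
  moreover have "C2_on UNIV (h n)" if "n < m" for n
    unfolding h_def[abs_def] using C2 kI[OF that] a by (intro C2_on_diff)
  ultimately show ?thesis unfolding C2_manifold_around_def using mem
    by (intro conjI exI[of _ UNIV] exI[of _ m] exI[of _ h]) auto
qed

section \<open>Maxima of smooth functions with affinely independent gradients\<close>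

text \<open>The data that determine the subdifferential of \<open>f\<close> near \<open>xb\<close>.
  C2 smoothness is condensed to one Lipschitz constant \<open>L\<close> for all gradients on one
  ball, affine independence to the directions \<open>W i\<close>.\<close>

locale max_family =
  fixes f :: "'a::euclidean_space \<Rightarrow> real" and I :: "'i set" and \<phi> :: "'i \<Rightarrow> 'a \<Rightarrow> real"
    and xb :: 'a and r L :: real and W :: "'i \<Rightarrow> 'a"
  assumes fin: "finite I" and ne: "I \<noteq> {}"
    and grad: "i \<in> I \<Longrightarrow> GDERIV (\<phi> i) x :> gradient (\<phi> i) x"
    and r: "r > 0" and L: "L \<ge> 0"
    and lip: "i \<in> I \<Longrightarrow> x \<in> ball xb r \<Longrightarrow> y \<in> ball xb r \<Longrightarrow>
      norm (gradient (\<phi> i) x - gradient (\<phi> i) y) \<le> L * norm (x - y)"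
    and fmax: "x \<in> ball xb r \<Longrightarrow> f x = Max ((\<lambda>i. \<phi> i x) ` I)"
    and contf: "continuous_on UNIV f"
    and common: "i \<in> I \<Longrightarrow> j \<in> I \<Longrightarrow> \<phi> i xb = \<phi> j xb"
    and dual: "i \<in> I \<Longrightarrow> j \<in> I \<Longrightarrow> k \<in> I \<Longrightarrow>
      (gradient (\<phi> j) xb - gradient (\<phi> k) xb) \<bullet> W i = (if i = j then 1 else 0) - (if i = k then 1 else 0)"
begin

abbreviation G :: "'i \<Rightarrow> 'a \<Rightarrow> 'a" where "G i \<equiv> gradient (\<phi> i)"

abbreviation M :: "'a set" where "M \<equiv> active_manifold I \<phi>"

text \<open>Informative inside the ball of radius \<open>r\<close>; outside it \<open>f\<close> is
  not tied to the \<open>\<phi> i\<close> and the set may be empty.\<close>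

definition active :: "'a \<Rightarrow> 'i set" where "active x = {i \<in> I. \<phi> i x = f x}"

lemma active_subset: "active x \<subseteq> I"
  by (auto simp: active_def)

lemma finite_active: "finite (active x)"
  using fin active_subset finite_subset by blast

lemma phi_le: "i \<in> I \<Longrightarrow> x \<in> ball xb r \<Longrightarrow> \<phi> i x \<le> f x"
  using fin by (simp add: fmax)

lemma active_nonempty: assumes "x \<in> ball xb r" shows "active x \<noteq> {}"
proof -
  have "f x \<in> (\<lambda>i. \<phi> i x) ` I" unfolding fmax[OF assms] using fin ne by (intro Max_in) auto
  then show ?thesis by (auto simp: active_def)
qed

lemma active_on_manifold: assumes "x \<in> ball xb r" shows "x \<in> M \<longleftrightarrow> active x = I"
proof
  assume "x \<in> M"
  then have "\<phi> i x = \<phi> j x" if "i \<in> I" "j \<in> I" for i j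
    using that unfolding active_manifold_def by blast
  moreover obtain j where "j \<in> I" "\<phi> j x = f x"
    using active_nonempty[OF assms] by (auto simp: active_def)
  ultimately have "\<phi> i x = f x" if "i \<in> I" for i using that by metis
  then show "active x = I" unfolding active_def by blast
next
  assume "active x = I"
  then have "\<phi> i x = f x" if "i \<in> I" for i using that unfolding active_def by blast
  then show "x \<in> M" unfolding active_manifold_def by simp
qed

lemma xb_in_manifold: "xb \<in> M"
  unfolding active_manifold_def using common by blast

lemma isCont_phi: "i \<in> I \<Longrightarrow> isCont (\<phi> i) x"
  using grad[of i x] has_derivative_continuous unfolding gderiv_def by blast

lemma isCont_f: "isCont f x"
  using contf continuous_on_eq_continuous_at open_UNIV by blast

lemma closed_manifold: "closed M"
proof -
  have "M = (\<Inter>i\<in>I. \<Inter>j\<in>I. {x. \<phi> i x = \<phi> j x})" by (auto simp: active_manifold_def)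
  moreover have "continuous_on UNIV (\<phi> i)" if "i \<in> I" for i
    using isCont_phi that continuous_at_imp_continuous_on by blast
  ultimately show ?thesis by (auto intro!: closed_INT closed_Collect_eq)
qed

lemma closest_in_manifold: "closest_point M x \<in> M"
  using closed_manifold xb_in_manifold closest_point_in_set by blast

lemma infdist_manifold: "infdist x M = dist x (closest_point M x)"
  using closed_manifold xb_in_manifold infdist_eq_closest_point by blast

lemma isCont_G: assumes "i \<in> I" "x \<in> ball xb r" shows "isCont (G i) x"
proof -
  have "L-lipschitz_on (ball xb r) (G i)"
    using lip assms L by (auto simp: lipschitz_on_def dist_norm)
  then show ?thesis
    using lipschitz_on_continuous_on continuous_on_eq_continuous_at assms(2) open_ball by blast
qed

text \<open>The constant is \<open>L\<close> and not half of it, since the variation of the gradient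
  is bounded uniformly along the segment instead of being integrated.\<close>

lemma taylor:
  assumes "i \<in> I" "x \<in> ball xb r" "y \<in> ball xb r"
  shows "\<bar>\<phi> i y - \<phi> i x - G i x \<bullet> (y - x)\<bar> \<le> L * (norm (y - x))\<^sup>2"
proof -
  have seg: "closed_segment x y \<subseteq> ball xb r"
    using assms by (meson closed_segment_subset convex_ball)
  have "norm (\<phi> i y - \<phi> i x - (\<lambda>h. h \<bullet> G i x) (y - x)) \<le> norm (y - x) * (L * norm (y - x))"
  proof (rule differentiable_bound_linearization
      [where S = "closed_segment x y" and f' = "\<lambda>z h. h \<bullet> G i z"])
    show "x + t *\<^sub>R (y - x) \<in> closed_segment x y" if "t \<in> {0..1}" for t
      using that by (auto simp: closed_segment_def algebra_simps intro!: exI[of _ t])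
    show "(\<phi> i has_derivative (\<lambda>h. h \<bullet> G i z)) (at z within closed_segment x y)" for z
      using grad[OF assms(1)] by (simp add: gderiv_def has_derivative_at_withinI)
    show "onorm ((\<lambda>h. h \<bullet> G i z) - (\<lambda>h. h \<bullet> G i x)) \<le> L * norm (y - x)"
      if z: "z \<in> closed_segment x y" for z
    proof (rule onorm_le)
      fix h
      have "\<bar>h \<bullet> (G i z - G i x)\<bar> \<le> norm h * norm (G i z - G i x)" by (rule Cauchy_Schwarz_ineq2)
      also have "\<dots> \<le> norm h * (L * norm (z - x))"
        using lip[OF assms(1) _ assms(2), of z] z seg by (intro mult_left_mono) auto
      also have "\<dots> \<le> norm h * (L * norm (y - x))"
        using segment_bound(1)[OF z] L by (intro mult_left_mono) auto
      finally show "norm (((\<lambda>h. h \<bullet> G i z) - (\<lambda>h. h \<bullet> G i x)) h) \<le> L * norm (y - x) * norm h"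
        by (simp add: inner_diff_right mult_ac)
    qed
  qed auto
  then show ?thesis by (simp add: inner_commute power2_eq_square mult_ac)
qed

lemma phi_line_deriv:
  assumes "i \<in> I"
  shows "((\<lambda>t. \<phi> i (x + t *\<^sub>R w)) has_real_derivative (G i x \<bullet> w)) (at 0)"
proof -
  have "((\<lambda>t. \<phi> i (x + t *\<^sub>R w)) has_derivative (\<lambda>h. (h *\<^sub>R w) \<bullet> G i x)) (at 0)"
    by (rule has_derivative_compose[of "\<lambda>t. x + t *\<^sub>R w" _ _ _ "\<phi> i"])
      (use grad[OF assms, of x] in \<open>auto intro!: derivative_eq_intros simp: gderiv_def\<close>)
  moreover have "(\<lambda>h. (h *\<^sub>R w) \<bullet> G i x) = (*) (G i x \<bullet> w)"
    by (auto simp: inner_commute mult.commute)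
  ultimately show ?thesis by (simp add: has_field_derivative_def)
qed

text \<open>The relations \<open>dual\<close> hold at \<open>xb\<close> alone; this carries them to
  nearby points with error \<open>\<eta>\<close> per gradient.\<close>

lemma gradients_near:
  assumes "\<eta> > 0"
  shows "\<exists>e>0. e \<le> r \<and> (\<forall>x\<in>ball xb e. \<forall>i\<in>I. \<forall>j\<in>I. \<bar>(G j x - G j xb) \<bullet> W i\<bar> \<le> \<eta>)"
proof -
  define S where "S = (\<Sum>i\<in>I. norm (W i))"
  have S: "norm (W i) \<le> S" if "i \<in> I" for i
    unfolding S_def using fin that by (intro member_le_sum) auto
  have S0: "S \<ge> 0" unfolding S_def by (intro sum_nonneg) auto
  \<comment> \<open>The error at distance \<open>e\<close> is at most \<open>L * e * S\<close>; the
    added 1 keeps the denominator positive.\<close>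
  define e where "e = min r (\<eta> / (L * S + 1))"
  have pos: "L * S + 1 > 0" using L S0 by (smt (verit) mult_nonneg_nonneg)
  then have e: "e > 0" "e \<le> r" using r assms by (auto simp: e_def)
  have "\<bar>(G j x - G j xb) \<bullet> W i\<bar> \<le> \<eta>" if "x \<in> ball xb e" "i \<in> I" "j \<in> I" for x i j
  proof -
    have nx: "norm (x - xb) \<le> e" using that(1) by (simp add: dist_norm norm_minus_commute)
    have "\<bar>(G j x - G j xb) \<bullet> W i\<bar> \<le> norm (G j x - G j xb) * norm (W i)" by (rule Cauchy_Schwarz_ineq2)
    also have "\<dots> \<le> (L * e) * S"
    proof (intro mult_mono)
      have "norm (G j x - G j xb) \<le> L * norm (x - xb)" using lip that e r by auto
      also have "\<dots> \<le> L * e" using nx L by (intro mult_left_mono) auto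
      finally show "norm (G j x - G j xb) \<le> L * e" .
    qed (use S that L e in auto)
    also have "\<dots> \<le> (L * S + 1) * e" using e by (simp add: algebra_simps)
    also have "\<dots> \<le> (L * S + 1) * (\<eta> / (L * S + 1))"
      using pos by (intro mult_left_mono) (auto simp: e_def)
    finally show ?thesis using pos by simp
  qed
  then show ?thesis using e by blast
qed

section \<open>The Clarke subdifferential near \<open>xb\<close>\<close>

text \<open>\<open>f - \<phi> i\<close> is nonnegative near \<open>x\<close> and zero at
  \<open>x\<close>, so its derivative there vanishes.\<close>

lemma gradient_at_differentiable:
  assumes "x \<in> ball xb r" "f differentiable (at x)" "i \<in> active x"
  shows "gradient f x = G i x"
proof -
  have i: "i \<in> I" "\<phi> i x = f x" using assms(3) by (auto simp: active_def)
  have D: "(f has_derivative (\<lambda>h. h \<bullet> gradient f x)) (at x)"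
    using assms(2) gradient_inner_eq(1) unfolding differentiable_def gderiv_def by blast
  have "((\<lambda>y. f y - \<phi> i y) has_derivative (\<lambda>h. h \<bullet> gradient f x - h \<bullet> G i x)) (at x)"
    using D grad[OF i(1), of x] unfolding gderiv_def by (rule has_derivative_diff)
  then have "(\<lambda>h. h \<bullet> gradient f x - h \<bullet> G i x) = (\<lambda>v. 0)"
    by (rule differential_zero_maxmin[OF assms(1) open_ball]) (use phi_le i in auto)
  then have "(gradient f x - G i x) \<bullet> (gradient f x - G i x) = 0"
    by (metis inner_diff_right)
  then show ?thesis by simp
qed

text \<open>Some index is active at infinitely many points of a defining sequence; along that
  subsequence the gradients are those of \<open>\<phi> i\<close>, and continuity makes
  \<open>i\<close> active at the limit. The hull of finitely many points is closed, so the closure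
  adds nothing.\<close>

lemma clarke_subset:
  assumes "x \<in> ball xb r"
  shows "clarke_subdiff f x \<subseteq> convex hull ((\<lambda>i. G i x) ` active x)"
proof -
  have "v \<in> (\<lambda>i. G i x) ` active x"
    if X: "X \<longlonglongrightarrow> x" "\<And>n. f differentiable (at (X n))" "(\<lambda>n. gradient f (X n)) \<longlonglongrightarrow> v" for X v
  proof -
    obtain N where N: "\<And>n. n \<ge> N \<Longrightarrow> X n \<in> ball xb r"
      using topological_tendstoD[OF X(1) open_ball assms] by (auto simp: eventually_sequentially)
    have "\<forall>n. \<exists>i. i \<in> active (X (n + N))" using active_nonempty[OF N] by (simp add: ex_in_conv)
    then obtain a where a: "\<And>n. a n \<in> active (X (n + N))" by metis
    have "range a \<subseteq> I" using a active_subset by blast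
    then have "finite (range a)" using fin finite_subset by blast
    then obtain i where i: "infinite {n. a n = i}"
      using pigeonhole_infinite[of UNIV a] by auto
    define s where "s = enumerate {n. a n = i}"
    have s: "strict_mono s" "\<And>n. a (s n) = i"
      using strict_mono_enumerate[OF i] enumerate_in_set[OF i] by (auto simp: s_def)
    define Y where "Y n = X (s n + N)" for n
    have sub: "strict_mono (\<lambda>n. s n + N)" using s(1) by (simp add: strict_mono_def)
    have Y: "Y \<longlonglongrightarrow> x" "(\<lambda>n. gradient f (Y n)) \<longlonglongrightarrow> v"
      using LIMSEQ_subseq_LIMSEQ[OF X(1) sub] LIMSEQ_subseq_LIMSEQ[OF X(3) sub]
      unfolding Y_def[abs_def] o_def by blast+
    have act: "i \<in> active (Y n)" for n using a[of "s n"] s by (simp add: Y_def)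
    then have iI: "i \<in> I" using active_subset by blast
    have "gradient f (Y n) = G i (Y n)" for n
      using gradient_at_differentiable act X(2) N by (simp add: Y_def)
    moreover have "(\<lambda>n. G i (Y n)) \<longlonglongrightarrow> G i x"
      using isCont_tendsto_compose[OF isCont_G[OF iI assms] Y(1)] .
    ultimately have "v = G i x" using Y(2) LIMSEQ_unique by auto
    moreover have "(\<lambda>n. \<phi> i (Y n)) \<longlonglongrightarrow> \<phi> i x" "(\<lambda>n. f (Y n)) \<longlonglongrightarrow> f x"
      using isCont_tendsto_compose[OF isCont_phi[OF iI] Y(1)]
        isCont_tendsto_compose[OF isCont_f Y(1)] by auto
    then have "\<phi> i x = f x" using act LIMSEQ_unique by (auto simp: active_def)
    ultimately show ?thesis using iI by (auto simp: active_def)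
  qed
  then have "convex hull {v. \<exists>X. X \<longlonglongrightarrow> x \<and> (\<forall>r. f differentiable (at (X r))) \<and>
      (\<lambda>r. gradient f (X r)) \<longlonglongrightarrow> v} \<subseteq> convex hull ((\<lambda>i. G i x) ` active x)"
    by (intro hull_mono) blast
  moreover have "closed (convex hull ((\<lambda>i. G i x) ` active x))"
    using finite_active by (intro compact_imp_closed finite_imp_compact_convex_hull) auto
  ultimately show ?thesis unfolding clarke_subdiff_def by (rule closure_minimal)
qed

text \<open>Along \<open>w\<close> the function \<open>\<phi> i\<close> overtakes all the others, so
  at points of this ray close to \<open>x\<close> the gradient of \<open>f\<close> is that of
  \<open>\<phi> i\<close>, and these gradients converge to the one at \<open>x\<close>.\<close>

lemma active_gradient_in_clarke:
  assumes x: "x \<in> ball xb r" and i: "i \<in> active x"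
    and dom: "\<And>k. k \<in> I \<Longrightarrow> k \<noteq> i \<Longrightarrow> (G i x - G k x) \<bullet> w > 0"
  shows "G i x \<in> clarke_subdiff f x"
proof -
  have iI: "i \<in> I" and fi: "\<phi> i x = f x" using i by (auto simp: active_def)
  have "\<forall>k\<in>I - {i}. \<forall>\<^sub>F t in at_right 0. \<phi> k (x + t *\<^sub>R w) < \<phi> i (x + t *\<^sub>R w)"
  proof
    fix k assume k: "k \<in> I - {i}"
    have "((\<lambda>t. \<phi> i (x + t *\<^sub>R w) - \<phi> k (x + t *\<^sub>R w)) has_real_derivative
        (G i x \<bullet> w - G k x \<bullet> w)) (at 0)"
      using k iI by (intro DERIV_diff phi_line_deriv) auto
    moreover have "G i x \<bullet> w - G k x \<bullet> w > 0" using dom k by (auto simp: inner_diff_left)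
    ultimately obtain d where d: "d > 0" "\<And>h. 0 < h \<Longrightarrow> h < d \<Longrightarrow>
        \<phi> i (x + 0 *\<^sub>R w) - \<phi> k (x + 0 *\<^sub>R w) < \<phi> i (x + (0 + h) *\<^sub>R w) - \<phi> k (x + (0 + h) *\<^sub>R w)"
      using DERIV_pos_inc_right by blast
    have "\<phi> k x \<le> \<phi> i x" using phi_le k x fi by auto
    then have "\<And>h. 0 < h \<Longrightarrow> h < d \<Longrightarrow> \<phi> k (x + h *\<^sub>R w) < \<phi> i (x + h *\<^sub>R w)"
      using d(2) by fastforce
    then show "\<forall>\<^sub>F t in at_right 0. \<phi> k (x + t *\<^sub>R w) < \<phi> i (x + t *\<^sub>R w)"
      using d(1) by (auto simp: eventually_at_right[of 0 1])
  qed
  then have "\<forall>\<^sub>F t in at_right 0. \<forall>k\<in>I - {i}. \<phi> k (x + t *\<^sub>R w) < \<phi> i (x + t *\<^sub>R w)"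
    using fin by (intro eventually_ball_finite) auto
  moreover have lim: "((\<lambda>t. x + t *\<^sub>R w) \<longlongrightarrow> x) (at_right 0)"
    by (auto intro!: tendsto_eq_intros)
  then have "\<forall>\<^sub>F t in at_right 0. x + t *\<^sub>R w \<in> ball xb r"
    using x by (intro topological_tendstoD) auto
  ultimately have "\<forall>\<^sub>F t in at_right 0. x + t *\<^sub>R w \<in> ball xb r \<and>
      (\<forall>k\<in>I - {i}. \<phi> k (x + t *\<^sub>R w) < \<phi> i (x + t *\<^sub>R w))"
    by eventually_elim simp
  then obtain b where b: "b > 0" "\<And>t. 0 < t \<Longrightarrow> t < b \<Longrightarrow> x + t *\<^sub>R w \<in> ball xb r"
      "\<And>t k. 0 < t \<Longrightarrow> t < b \<Longrightarrow> k \<in> I \<Longrightarrow> k \<noteq> i \<Longrightarrow> \<phi> k (x + t *\<^sub>R w) < \<phi> i (x + t *\<^sub>R w)"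
    by (auto simp: eventually_at_right[of 0 1])
  \<comment> \<open>The denominator \<open>n + 2\<close> keeps \<open>t n\<close> strictly below
    \<open>b\<close> already for \<open>n = 0\<close>.\<close>
  define t where "t n = b * inverse (real (Suc (Suc n)))" for n
  have t: "0 < t n" "t n < b" for n using b(1) by (auto simp: t_def field_simps add_pos_nonneg)
  have t0: "t \<longlonglongrightarrow> 0" unfolding t_def
    using tendsto_mult_right_zero[OF LIMSEQ_Suc[OF LIMSEQ_inverse_real_of_nat]] .
  define X where "X n = x + t n *\<^sub>R w" for n
  have X: "X \<longlonglongrightarrow> x" unfolding X_def by (auto intro!: tendsto_eq_intros t0)
  have GX: "GDERIV f (X n) :> G i (X n)" for n
  proof -
    \<comment> \<open>Strict inequalities survive in a neighbourhood, so \<open>f\<close> agrees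
      with \<open>\<phi> i\<close> around \<open>X n\<close> and not only on the ray.\<close>
    have "\<forall>\<^sub>F y in nhds (X n). \<forall>k\<in>I - {i}. \<phi> k y < \<phi> i y"
    proof (intro eventually_ball_finite ballI)
      fix k assume k: "k \<in> I - {i}"
      have "isCont (\<lambda>y. \<phi> i y - \<phi> k y) (X n)" using k iI isCont_phi by auto
      then have "((\<lambda>y. \<phi> i y - \<phi> k y) \<longlongrightarrow> \<phi> i (X n) - \<phi> k (X n)) (nhds (X n))"
        by (simp add: isCont_def tendsto_at_iff_tendsto_nhds[of "\<lambda>y. \<phi> i y - \<phi> k y"])
      moreover have "0 < \<phi> i (X n) - \<phi> k (X n)" using b(3)[OF t, of k] k by (auto simp: X_def)
      ultimately have "\<forall>\<^sub>F y in nhds (X n). 0 < \<phi> i y - \<phi> k y" by (rule order_tendstoD)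
      then show "\<forall>\<^sub>F y in nhds (X n). \<phi> k y < \<phi> i y" by eventually_elim simp
    qed (use fin in auto)
    moreover have "\<forall>\<^sub>F y in nhds (X n). y \<in> ball xb r"
      using b(2)[OF t] by (intro eventually_nhds_in_open) (auto simp: X_def)
    ultimately have ev: "\<forall>\<^sub>F y in nhds (X n). \<phi> i y = f y"
    proof eventually_elim
      case (elim y)
      obtain j where "j \<in> active y" using active_nonempty elim by blast
      then have "j \<in> I" "\<phi> j y = f y" by (auto simp: active_def)
      moreover have "j = i"
        using \<open>j \<in> I\<close> \<open>\<phi> j y = f y\<close> elim phi_le[OF iI, of y] by (metis DiffI leD singletonD)
      ultimately show ?case by simp
    qed
    have "(f has_derivative (\<lambda>h. h \<bullet> G i (X n))) (at (X n))"
    proof (rule has_derivative_transform_eventually)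
      show "(\<phi> i has_derivative (\<lambda>h. h \<bullet> G i (X n))) (at (X n) within UNIV)"
        using grad[OF iI] by (simp add: gderiv_def)
      show "\<forall>\<^sub>F y in at (X n) within UNIV. \<phi> i y = f y"
        using ev eventually_nhds_conv_at by blast
      show "\<phi> i (X n) = f (X n)" using ev eventually_nhds_x_imp_x by blast
    qed simp
    then show ?thesis by (simp add: gderiv_def)
  qed
  have "(\<lambda>n. gradient f (X n)) \<longlonglongrightarrow> G i x"
    using isCont_tendsto_compose[OF isCont_G[OF iI x] X] gradient_eqI[OF GX] by simp
  moreover have "f differentiable (at (X n))" for n
    using GX unfolding gderiv_def differentiable_def by blast
  ultimately show ?thesis unfolding clarke_subdiff_def
    using X by (intro closure_subset[THEN subsetD] hull_inc) blast
qed

lemma clarke_eq: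
  "\<exists>e>0. e \<le> r \<and> (\<forall>x\<in>ball xb e. clarke_subdiff f x = convex hull ((\<lambda>i. G i x) ` active x))"
proof -
  \<comment> \<open>At \<open>xb\<close> the gradient of \<open>\<phi> i\<close> exceeds each other
    one by 1 in the direction \<open>W i\<close>; two errors of 1/4 keep the gap positive.\<close>
  obtain e where e: "e > 0" "e \<le> r"
      "\<And>x i j. x \<in> ball xb e \<Longrightarrow> i \<in> I \<Longrightarrow> j \<in> I \<Longrightarrow> \<bar>(G j x - G j xb) \<bullet> W i\<bar> \<le> 1/4"
    using gradients_near[of "1/4"] by auto
  have "clarke_subdiff f x = convex hull ((\<lambda>i. G i x) ` active x)" if x: "x \<in> ball xb e" for x
  proof
    have xr: "x \<in> ball xb r" using x e by auto
    show "clarke_subdiff f x \<subseteq> convex hull ((\<lambda>i. G i x) ` active x)" by (rule clarke_subset[OF xr])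
    have "G i x \<in> clarke_subdiff f x" if i: "i \<in> active x" for i
    proof (rule active_gradient_in_clarke[OF xr i, of "W i"])
      fix k assume k: "k \<in> I" "k \<noteq> i"
      have iI: "i \<in> I" using i active_subset by blast
      have "(G i xb - G k xb) \<bullet> W i = 1" using dual[OF iI iI k(1)] k by simp
      then show "0 < (G i x - G k x) \<bullet> W i"
        using e(3)[OF x iI iI] e(3)[OF x iI k(1)] unfolding inner_diff_left by linarith
    qed
    moreover have "convex (clarke_subdiff f x)"
      by (simp add: clarke_subdiff_def convex_closure)
    ultimately show "convex hull ((\<lambda>i. G i x) ` active x) \<subseteq> clarke_subdiff f x"
      by (intro hull_minimal) auto
  qed
  then show ?thesis using e by blast
qed

section \<open>Regularity and the upper Lipschitz property\<close>

text \<open>On the manifold all indices are active, so the difference quotient of the maximum is the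
  maximum of the difference quotients; its limit is the support function of the hull of all the
  gradients.\<close>

lemma regular_on_manifold: "\<forall>\<^sub>F x in nhds xb. x \<in> M \<longrightarrow> subdiff_regular f x"
proof -
  obtain e where e: "e > 0" "e \<le> r"
      "\<And>x. x \<in> ball xb e \<Longrightarrow> clarke_subdiff f x = convex hull ((\<lambda>i. G i x) ` active x)"
    using clarke_eq by blast
  have "subdiff_regular f x" if x: "x \<in> ball xb e" "x \<in> M" for x
    unfolding subdiff_regular_def
  proof
    fix y
    have xr: "x \<in> ball xb r" using x e by auto
    have act: "active x = I" using active_on_manifold[OF xr] x by simp
    have eq: "\<phi> i x = f x" if "i \<in> I" for i using act that by (auto simp: active_def)
    have "(SUP v\<in>clarke_subdiff f x. v \<bullet> y) = Max ((\<lambda>i. G i x \<bullet> y) ` I)"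
    proof (rule cSup_eq_maximum)
      have "Max ((\<lambda>i. G i x \<bullet> y) ` I) \<in> (\<lambda>i. G i x \<bullet> y) ` I" using fin ne by (intro Max_in) auto
      then show "Max ((\<lambda>i. G i x \<bullet> y) ` I) \<in> (\<lambda>v. v \<bullet> y) ` clarke_subdiff f x"
        using e(3)[OF x(1)] act by (auto intro!: image_eqI hull_inc)
      have "convex hull ((\<lambda>i. G i x) ` I) \<subseteq> {v. y \<bullet> v \<le> Max ((\<lambda>i. G i x \<bullet> y) ` I)}"
        using fin by (intro hull_minimal convex_halfspace_le) (auto simp: inner_commute)
      then show "z \<le> Max ((\<lambda>i. G i x \<bullet> y) ` I)" if "z \<in> (\<lambda>v. v \<bullet> y) ` clarke_subdiff f x" for z
        using that e(3)[OF x(1)] act by (auto simp: inner_commute)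
    qed
    moreover have "((\<lambda>t. Max ((\<lambda>i. (\<phi> i (x + t *\<^sub>R y) - \<phi> i x) / t) ` I)) \<longlongrightarrow>
        Max ((\<lambda>i. G i x \<bullet> y) ` I)) (at_right 0)"
    proof (rule tendsto_Max_image[OF fin ne])
      fix i assume "i \<in> I"
      then have "(\<lambda>t. (\<phi> i (x + t *\<^sub>R y) - \<phi> i x) / t) \<midarrow>0\<rightarrow> G i x \<bullet> y"
        using phi_line_deriv[of i x y] by (simp add: DERIV_def)
      then show "((\<lambda>t. (\<phi> i (x + t *\<^sub>R y) - \<phi> i x) / t) \<longlongrightarrow> G i x \<bullet> y) (at_right 0)"
        by (rule tendsto_within_subset) auto
    qed
    moreover have "\<forall>\<^sub>F t in at_right 0. Max ((\<lambda>i. (\<phi> i (x + t *\<^sub>R y) - \<phi> i x) / t) ` I) =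
        (f (x + t *\<^sub>R y) - f x) / t"
    proof -
      have "((\<lambda>t. x + t *\<^sub>R y) \<longlongrightarrow> x) (at_right 0)" by (auto intro!: tendsto_eq_intros)
      then have "\<forall>\<^sub>F t in at_right 0. x + t *\<^sub>R y \<in> ball xb r"
        using xr by (intro topological_tendstoD) auto
      moreover have "\<forall>\<^sub>F t in at_right 0. (t::real) > 0" by (simp add: eventually_at_right_less)
      ultimately show ?thesis
      proof eventually_elim
        case (elim t)
        have "(f (x + t *\<^sub>R y) - f x) / t = Max ((\<lambda>s. (s - f x) / t) ` (\<lambda>i. \<phi> i (x + t *\<^sub>R y)) ` I)"
          unfolding fmax[OF elim(1)] using elim fin ne
          by (intro mono_Max_commute) (auto intro!: monoI divide_right_mono)
        also have "(\<lambda>s. (s - f x) / t) ` (\<lambda>i. \<phi> i (x + t *\<^sub>R y)) ` I =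
            (\<lambda>i. (\<phi> i (x + t *\<^sub>R y) - \<phi> i x) / t) ` I"
          using eq by (auto simp: image_iff)
        finally show ?case by simp
      qed
    qed
    ultimately show "((\<lambda>t. (f (x + t *\<^sub>R y) - f x) / t) \<longlongrightarrow>
        (SUP v\<in>clarke_subdiff f x. v \<bullet> y)) (at_right 0)"
      using Lim_transform_eventually by simp
  qed
  then show ?thesis using e(1) by (auto simp: eventually_nhds_metric dist_commute)
qed

lemma convex_combination_near:
  assumes "x \<in> ball xb r" "y \<in> ball xb r" "v \<in> convex hull ((\<lambda>i. G i y) ` I)"
  shows "\<exists>w\<in>convex hull ((\<lambda>i. G i x) ` I). norm (v - w) \<le> L * norm (y - x)"
proof -
  obtain u where u: "\<And>i. i \<in> I \<Longrightarrow> 0 \<le> u i" "sum u I = 1" "v = (\<Sum>i\<in>I. u i *\<^sub>R G i y)"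
    using assms(3) unfolding convex_hull_image_finite[OF fin] by blast
  have "norm (v - (\<Sum>i\<in>I. u i *\<^sub>R G i x)) = norm (\<Sum>i\<in>I. u i *\<^sub>R (G i y - G i x))"
    by (simp add: u(3) scaleR_diff_right sum_subtractf)
  also have "\<dots> \<le> (\<Sum>i\<in>I. u i * (L * norm (y - x)))"
    using lip[OF _ assms(2,1)] u(1) by (intro sum_norm_le) (auto intro!: mult_left_mono)
  also have "\<dots> = L * norm (y - x)" using u(2) by (simp flip: sum_distrib_right)
  finally show ?thesis unfolding convex_hull_image_finite[OF fin] using u by blast
qed

text \<open>At a point of the manifold all indices are active, so weights on the indices active at a
  nearby \<open>y\<close> are admissible there too.\<close>

lemma upper_lipschitz: "upper_lipschitz_subdiff f M xb"
proof -
  obtain e where e: "e > 0" "e \<le> r"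
      "\<And>x. x \<in> ball xb e \<Longrightarrow> clarke_subdiff f x = convex hull ((\<lambda>i. G i x) ` active x)"
    using clarke_eq by blast
  \<comment> \<open>The factor is \<open>L + 1\<close> because \<open>K\<close> must be positive and
    \<open>L\<close> may be 0.\<close>
  have "clarke_subdiff f y \<subseteq>
      {v + ((L + 1) * norm (x - y)) *\<^sub>R b | v b. v \<in> clarke_subdiff f x \<and> b \<in> cball 0 1}"
    if x: "x \<in> M" "x \<in> ball xb e" and y: "y \<in> ball xb e" for x y
  proof
    fix v assume v: "v \<in> clarke_subdiff f y"
    have xr: "x \<in> ball xb r" "y \<in> ball xb r" using x y e by auto
    have "v \<in> convex hull ((\<lambda>i. G i y) ` I)"
      using v e(3)[OF y] active_subset by (metis hull_mono image_mono subsetD)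
    then obtain w where w: "w \<in> convex hull ((\<lambda>i. G i x) ` I)" "norm (v - w) \<le> L * norm (x - y)"
      using convex_combination_near[OF xr] by (metis norm_minus_commute)
    have wc: "w \<in> clarke_subdiff f x"
      using w(1) e(3)[OF x(2)] x(1) active_on_manifold[OF xr(1)] by simp
    define s where "s = (L + 1) * norm (x - y)"
    have s_nonneg: "s \<ge> 0" using L by (simp add: s_def)
    have "norm (v - w) \<le> s"
      using w(2) norm_ge_zero[of "x - y"] unfolding s_def distrib_right by linarith
    \<comment> \<open>For \<open>s = 0\<close> both \<open>v - w\<close> and, by the default value
      of division, \<open>1 / s\<close> are 0.\<close>
    then have "v = w + s *\<^sub>R ((1 / s) *\<^sub>R (v - w)) \<and> (1 / s) *\<^sub>R (v - w) \<in> cball 0 1"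
      using s_nonneg by (cases "s = 0") (use \<open>norm (v - w) \<le> s\<close> in \<open>auto simp: divide_le_eq_1\<close>)
    then show "v \<in> {v + ((L + 1) * norm (x - y)) *\<^sub>R b | v b. v \<in> clarke_subdiff f x \<and> b \<in> cball 0 1}"
      using wc unfolding s_def by blast
  qed
  then show ?thesis unfolding upper_lipschitz_subdiff_def
    using e(1) L by (intro exI[of _ "L + 1"] conjI exI[of _ e]) auto
qed

end

section \<open>Growth around a nondegenerate critical point\<close>

text \<open>Positive multipliers are the form in which nondegeneracy enters.
  \<open>trapezoid\<close> carries the second-order information and is applied with a tolerance
  small against \<open>\<delta>\<close>.\<close>

locale sharp_max_family = max_family f I \<phi> xb r L W
  for f :: "'a::euclidean_space \<Rightarrow> real" and I :: "'i set" and \<phi> xb r L W +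
  fixes lam :: "'i \<Rightarrow> real" and \<delta> :: real
  assumes lam_pos: "i \<in> I \<Longrightarrow> lam i > 0"
    and lam_sum: "sum lam I = 1"
    and lam_zero: "(\<Sum>i\<in>I. lam i *\<^sub>R gradient (\<phi> i) xb) = 0"
    and \<delta>: "\<delta> > 0"
    and growth: "x \<in> ball xb r \<Longrightarrow> \<delta> / 2 * (norm (x - xb))\<^sup>2 \<le> f x - f xb"
    and trapezoid: "\<eta> > 0 \<Longrightarrow> \<exists>e>0. \<forall>i\<in>I. \<forall>y\<in>ball xb e.
      \<bar>2 * (\<phi> i y - \<phi> i xb) - (gradient (\<phi> i) y + gradient (\<phi> i) xb) \<bullet> (y - xb)\<bar>
        \<le> \<eta> * (norm (y - xb))\<^sup>2"
begin

text \<open>\<open>dual\<close> fixes only differences of inner products. Averaging over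
  \<open>k\<close> with the weights \<open>lam\<close> removes the subtracted gradient by
  criticality and so fixes the inner products themselves.\<close>

lemma gradient_inner_dual:
  assumes "i \<in> I" "j \<in> I"
  shows "G j xb \<bullet> W i = (if i = j then 1 else 0) - lam i"
proof -
  have "G j xb \<bullet> W i = (\<Sum>k\<in>I. lam k * (G j xb \<bullet> W i)) - (\<Sum>k\<in>I. lam k *\<^sub>R G k xb) \<bullet> W i"
    using lam_sum lam_zero by (simp flip: sum_distrib_right)
  also have "\<dots> = (\<Sum>k\<in>I. lam k * ((G j xb - G k xb) \<bullet> W i))"
    by (simp add: inner_sum_left inner_diff_left right_diff_distrib sum_subtractf)
  also have "\<dots> = (\<Sum>k\<in>I. lam k * (if i = j then 1 else 0) - (if i = k then lam i else 0))"
    using dual assms by (intro sum.cong) (auto simp: right_diff_distrib)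
  also have "\<dots> = (if i = j then 1 else 0) - lam i"
    using fin assms lam_sum by (simp add: sum_subtractf flip: sum_distrib_right)
  finally show ?thesis .
qed

section \<open>Growth of \<open>f\<close> off the manifold\<close>

lemma dual_bound: "\<exists>S>0. \<forall>i\<in>I. norm (W i) \<le> S"
proof -
  have "norm (W i) \<le> (\<Sum>i\<in>I. norm (W i)) + 1" if "i \<in> I" for i
    using member_le_sum[OF that, of "\<lambda>i. norm (W i)"] fin by auto
  moreover have "(\<Sum>i\<in>I. norm (W i)) + 1 > 0" by (intro add_nonneg_pos sum_nonneg) auto
  ultimately show ?thesis by blast
qed

lemma f_on_manifold: "x \<in> M \<Longrightarrow> x \<in> ball xb r \<Longrightarrow> i \<in> I \<Longrightarrow> \<phi> i x = f x"
  using active_on_manifold unfolding active_def by blast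

text \<open>Replaces the nonsmooth \<open>f\<close> on the manifold by a smooth function with zero
  gradient at \<open>xb\<close>.\<close>

lemma weighted_sum_eq:
  assumes "x \<in> M" "x \<in> ball xb r"
  shows "(\<Sum>i\<in>I. lam i * \<phi> i x) = f x"
  using f_on_manifold[OF assms] lam_sum by (simp flip: sum_distrib_right)

text \<open>Along \<open>W j\<close> every \<open>\<phi> i\<close> with \<open>i \<noteq> j\<close> decreases at rate about \<open>lam j\<close>, so off the
  manifold, where some \<open>j\<close> is inactive, \<open>f + \<kappa> \<bar>\<sqdot> - x\<bar>\<close> has no local minimizer.\<close>

lemma error_bound:
  "\<exists>\<kappa>>0. \<forall>\<rho>>0. \<exists>e>0. \<forall>x\<in>ball xb e. \<exists>z\<in>M. z \<in> ball xb \<rho> \<and> \<kappa> * norm (x - z) \<le> f x - f z"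
proof -
  define m where "m = Min (lam ` I)"
  have m: "m > 0" "\<And>i. i \<in> I \<Longrightarrow> m \<le> lam i" using fin ne lam_pos by (auto simp: m_def)
  obtain e1 where e1: "e1 > 0" "e1 \<le> r"
      "\<And>x i j. x \<in> ball xb e1 \<Longrightarrow> i \<in> I \<Longrightarrow> j \<in> I \<Longrightarrow> \<bar>(G j x - G j xb) \<bullet> W i\<bar> \<le> m / 2"
    using gradients_near[of "m / 2"] m by auto
  have decr: "G i x \<bullet> W j \<le> - m / 2" if "x \<in> ball xb e1" "i \<in> I" "j \<in> I" "i \<noteq> j" for x i j
  proof -
    have "G i xb \<bullet> W j = - lam j" using gradient_inner_dual[OF that(3,2)] that(4) by simp
    then show ?thesis
      using e1(3)[OF that(1,3,2)] m(2)[OF that(3)] unfolding inner_diff_left by linarith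
  qed
  obtain S where S: "S > 0" "\<And>i. i \<in> I \<Longrightarrow> norm (W i) \<le> S" using dual_bound by blast
  \<comment> \<open>A short step \<open>t\<close> along \<open>W j\<close> raises the penalty by at
    most \<open>t * (m / 4)\<close>, half of the drop promised by the slope
    \<open>- m / 2\<close>.\<close>
  define \<kappa> where "\<kappa> = m / (4 * S)"
  have \<kappa>: "\<kappa> > 0" using m S by (simp add: \<kappa>_def)
  have \<kappa>W: "\<kappa> * norm (W j) \<le> m / 4" if "j \<in> I" for j
  proof -
    have "\<kappa> * norm (W j) \<le> \<kappa> * S" using S(2)[OF that] \<kappa> by (intro mult_left_mono) auto
    then show ?thesis using S(1) by (simp add: \<kappa>_def)
  qed
  have "\<exists>e>0. \<forall>x\<in>ball xb e. \<exists>z\<in>M. z \<in> ball xb \<rho> \<and> \<kappa> * norm (x - z) \<le> f x - f z" if "\<rho> > 0" for \<rho>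
  proof -
    \<comment> \<open>The minimizer below lies within \<open>2 * \<sigma>\<close> of
      \<open>xb\<close>; this must stay inside the ball of radius \<open>\<rho>\<close> and in the
      interior of the ball over which \<open>h\<close> is minimized.\<close>
    define \<sigma> where "\<sigma> = min (e1 / 8) (\<rho> / 2)"
    have \<sigma>: "\<sigma> > 0" "\<sigma> \<le> e1 / 8" "\<sigma> \<le> \<rho> / 2" using e1 that by (auto simp: \<sigma>_def)
    have "\<forall>d>0. \<exists>s>0. \<forall>x'. dist x' xb < s \<longrightarrow> dist (f x') (f xb) < d"
      using isCont_f[of xb] by (simp add: continuous_at_eps_delta)
    then obtain s where s: "s > 0" "\<And>x. dist x xb < s \<Longrightarrow> dist (f x) (f xb) < \<kappa> * \<sigma>"
      using \<kappa> \<sigma>(1) by (meson mult_pos_pos)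
    define e where "e = min s \<sigma>"
    have "\<exists>z\<in>M. z \<in> ball xb \<rho> \<and> \<kappa> * norm (x - z) \<le> f x - f z" if x: "x \<in> ball xb e" for x
    proof -
      have xs: "dist x xb < s" "dist x xb < \<sigma>" using x by (auto simp: e_def dist_commute)
      \<comment> \<open>Ekeland-type penalty. Comparing a minimizer \<open>z\<close> with
        \<open>x\<close> gives the claimed inequality, and since \<open>f xb \<le> f z\<close> this
        also forces \<open>z\<close> close to \<open>x\<close>.\<close>
      define h where "h z = f z + \<kappa> * norm (z - x)" for z
      have "continuous_on (cball xb (e1 / 2)) h"
        unfolding h_def by (intro continuous_intros continuous_on_subset[OF contf]) auto
      then obtain z where z: "z \<in> cball xb (e1 / 2)" "\<And>y. y \<in> cball xb (e1 / 2) \<Longrightarrow> h z \<le> h y"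
        using continuous_attains_inf[of "cball xb (e1 / 2)" h] e1(1) by auto
      have "x \<in> cball xb (e1 / 2)" using xs \<sigma> e1 by (simp add: dist_commute)
      then have main: "\<kappa> * norm (z - x) \<le> f x - f z" using z(2)[of x] by (simp add: h_def)
      have "z \<in> ball xb r" using z(1) e1 by auto
      then have "f xb \<le> f z" using growth[of z] \<delta> by (smt (verit) divide_nonneg_nonneg mult_nonneg_nonneg zero_le_power2)
      moreover have "f x - f xb < \<kappa> * \<sigma>" using s(2)[OF xs(1)] by (simp add: dist_real_def)
      ultimately have "\<kappa> * norm (z - x) < \<kappa> * \<sigma>" using main by linarith
      then have "norm (z - x) < \<sigma>" using \<kappa> by simp
      then have zxb: "dist xb z < 2 * \<sigma>"
        using xs(2) dist_triangle[of xb z x] by (simp add: dist_norm norm_minus_commute)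
      then have zb: "z \<in> ball xb e1" "z \<in> ball xb r" "z \<in> ball xb (e1 / 2)" "z \<in> ball xb \<rho>"
        using \<sigma> e1 by auto
      have "z \<in> M"
      proof (rule ccontr)
        assume "z \<notin> M"
        then obtain j where j: "j \<in> I" "\<phi> j z \<noteq> f z"
          using active_on_manifold[OF zb(2)] unfolding active_def by blast
        \<comment> \<open>Active indices differ from \<open>j\<close> and decrease along
          \<open>W j\<close>; inactive ones start strictly below \<open>f z\<close>, so continuity
          suffices.\<close>
        have ev: "\<forall>i\<in>I. \<forall>\<^sub>F t in at_right 0. \<phi> i (z + t *\<^sub>R W j) + t * (m / 4) < f z"
        proof
          fix i assume i: "i \<in> I"
          have D: "((\<lambda>t. \<phi> i (z + t *\<^sub>R W j) + t * (m / 4)) has_real_derivative (G i z \<bullet> W j + m / 4)) (at 0)"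
            by (intro DERIV_add phi_line_deriv i) (auto intro!: derivative_eq_intros)
          show "\<forall>\<^sub>F t in at_right 0. \<phi> i (z + t *\<^sub>R W j) + t * (m / 4) < f z"
          proof (cases "\<phi> i z = f z")
            case True
            then have "i \<noteq> j" using j by blast
            then have "G i z \<bullet> W j + m / 4 < 0" using decr[OF zb(1) i j(1)] m by simp
            then obtain d where "d > 0" "\<And>h. 0 < h \<Longrightarrow> h < d \<Longrightarrow>
                \<phi> i (z + (0 + h) *\<^sub>R W j) + (0 + h) * (m / 4) < \<phi> i (z + 0 *\<^sub>R W j) + 0 * (m / 4)"
              using DERIV_neg_dec_right[OF D] by blast
            then show ?thesis using True by (auto simp: eventually_at_right[of 0 1])
          next
            case False
            then have less: "\<phi> i z < f z" using phi_le[OF i zb(2)] by simp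
            have "(\<lambda>t. \<phi> i (z + t *\<^sub>R W j) + t * (m / 4)) \<midarrow>0\<rightarrow> \<phi> i z"
              using DERIV_isCont[OF D] by (simp add: isCont_def)
            then have "((\<lambda>t. \<phi> i (z + t *\<^sub>R W j) + t * (m / 4)) \<longlongrightarrow> \<phi> i z) (at_right 0)"
              by (rule tendsto_within_subset) auto
            then show ?thesis using less by (rule order_tendstoD)
          qed
        qed
        have "\<forall>\<^sub>F t in at_right 0. \<forall>i\<in>I. \<phi> i (z + t *\<^sub>R W j) + t * (m / 4) < f z"
          using ev fin by (intro eventually_ball_finite)
        moreover have "((\<lambda>t. z + t *\<^sub>R W j) \<longlongrightarrow> z) (at_right 0)" by (auto intro!: tendsto_eq_intros)
        then have "\<forall>\<^sub>F t in at_right 0. z + t *\<^sub>R W j \<in> ball xb (e1 / 2)"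
          using zb(3) by (intro topological_tendstoD) auto
        moreover have "\<forall>\<^sub>F t in at_right 0. (t::real) > 0" by (simp add: eventually_at_right_less)
        ultimately have "\<forall>\<^sub>F t in at_right (0::real). False"
        proof eventually_elim
          case (elim t)
          define y where "y = z + t *\<^sub>R W j"
          have y: "y \<in> ball xb r" "y \<in> cball xb (e1 / 2)" using elim e1 by (auto simp: y_def)
          obtain i where "i \<in> I" "\<phi> i y = f y" using active_nonempty[OF y(1)] by (auto simp: active_def)
          then have "f y + t * (m / 4) < f z" using elim by (auto simp: y_def)
          moreover have "\<kappa> * norm (y - x) \<le> \<kappa> * norm (z - x) + t * (m / 4)"
          proof -
            have "norm (y - x) \<le> norm (z - x) + norm (t *\<^sub>R W j)"
              using norm_triangle_ineq[of "z - x" "t *\<^sub>R W j"] by (simp add: y_def algebra_simps)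
            then have "norm (y - x) \<le> norm (z - x) + t * norm (W j)" using elim by simp
            then have "\<kappa> * norm (y - x) \<le> \<kappa> * (norm (z - x) + t * norm (W j))"
              using \<kappa> by (intro mult_left_mono) auto
            also have "\<dots> = \<kappa> * norm (z - x) + t * (\<kappa> * norm (W j))" by (simp add: algebra_simps)
            also have "\<dots> \<le> \<kappa> * norm (z - x) + t * (m / 4)"
              using \<kappa>W[OF j(1)] elim by (intro add_left_mono mult_left_mono) auto
            finally show ?thesis .
          qed
          moreover have "h z \<le> h y" by (rule z(2)[OF y(2)])
          ultimately show ?case by (simp add: h_def)
        qed
        then show False by (simp add: eventually_False)
      qed
      then show ?thesis using main zb(4) by (metis norm_minus_commute)
    qed
    moreover have "e > 0" using s(1) \<sigma>(1) by (simp add: e_def)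
    ultimately show ?thesis by blast
  qed
  then show ?thesis using \<kappa> by blast
qed

text \<open>The gradient of the weighted sum vanishes at \<open>xb\<close>, so it is small on a
  small ball.\<close>

lemma weighted_sum_lipschitz:
  assumes "\<eta> > 0"
  shows "\<exists>e>0. e \<le> r \<and> (\<forall>x\<in>ball xb e. \<forall>y\<in>ball xb e.
    \<bar>(\<Sum>i\<in>I. lam i * \<phi> i y) - (\<Sum>i\<in>I. lam i * \<phi> i x)\<bar> \<le> \<eta> * norm (y - x))"
proof -
  \<comment> \<open>On this ball the gradient contributes \<open>L * e\<close> and the Taylor
    remainder \<open>2 * L * e\<close>.\<close>
  define e where "e = min r (\<eta> / (3 * L + 1))"
  have e: "e > 0" "e \<le> r" using r L assms by (auto simp: e_def)
  have Le: "3 * L * e \<le> \<eta>"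
  proof -
    have "3 * L * e \<le> (3 * L + 1) * e" using e by (simp add: algebra_simps)
    also have "\<dots> \<le> (3 * L + 1) * (\<eta> / (3 * L + 1))" using L by (intro mult_left_mono) (auto simp: e_def)
    finally show ?thesis using L by simp
  qed
  have "\<bar>(\<Sum>i\<in>I. lam i * \<phi> i y) - (\<Sum>i\<in>I. lam i * \<phi> i x)\<bar> \<le> \<eta> * norm (y - x)"
    if x: "x \<in> ball xb e" and y: "y \<in> ball xb e" for x y
  proof -
    have xb: "x \<in> ball xb r" "y \<in> ball xb r" "xb \<in> ball xb r" using x y e r by auto
    have xe: "norm (x - xb) \<le> e" "norm (y - x) \<le> 2 * e"
      using x y dist_triangle[of y x xb] by (auto simp: dist_norm norm_minus_commute)
    define g where "g = (\<Sum>i\<in>I. lam i *\<^sub>R G i x)"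
    have "g = (\<Sum>i\<in>I. lam i *\<^sub>R (G i x - G i xb))"
      using lam_zero by (simp add: g_def scaleR_diff_right sum_subtractf)
    also have "norm \<dots> \<le> (\<Sum>i\<in>I. lam i * (L * e))"
    proof (rule sum_norm_le)
      fix i assume i: "i \<in> I"
      have "norm (G i x - G i xb) \<le> L * norm (x - xb)" using lip[OF i xb(1,3)] .
      also have "\<dots> \<le> L * e" using xe L by (intro mult_left_mono) auto
      finally show "norm (lam i *\<^sub>R (G i x - G i xb)) \<le> lam i * (L * e)"
        using lam_pos[OF i] by (simp add: mult_left_mono)
    qed
    finally have g: "norm g \<le> L * e" using lam_sum by (simp flip: sum_distrib_right)
    have eq: "(\<Sum>i\<in>I. lam i * \<phi> i y) - (\<Sum>i\<in>I. lam i * \<phi> i x) =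
        (\<Sum>i\<in>I. lam i * (\<phi> i y - \<phi> i x - G i x \<bullet> (y - x))) + g \<bullet> (y - x)"
      by (simp add: g_def inner_sum_left right_diff_distrib sum_subtractf)
    have "\<bar>\<Sum>i\<in>I. lam i * (\<phi> i y - \<phi> i x - G i x \<bullet> (y - x))\<bar> \<le> (\<Sum>i\<in>I. lam i * (L * (norm (y - x))\<^sup>2))"
    proof (rule order_trans[OF sum_abs], rule sum_mono)
      fix i assume i: "i \<in> I"
      show "\<bar>lam i * (\<phi> i y - \<phi> i x - G i x \<bullet> (y - x))\<bar> \<le> lam i * (L * (norm (y - x))\<^sup>2)"
        using taylor[OF i xb(1,2)] lam_pos[OF i] by (simp add: abs_mult mult_left_mono)
    qed
    also have "\<dots> = L * (norm (y - x))\<^sup>2" using lam_sum by (simp flip: sum_distrib_right)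
    also have "\<dots> \<le> (L * (2 * e)) * norm (y - x)"
      using mult_left_mono[OF xe(2) L]
      by (simp add: power2_eq_square mult_right_mono flip: mult.assoc)
    finally have 1: "\<bar>\<Sum>i\<in>I. lam i * (\<phi> i y - \<phi> i x - G i x \<bullet> (y - x))\<bar> \<le> (L * (2 * e)) * norm (y - x)" .
    have "\<bar>g \<bullet> (y - x)\<bar> \<le> norm g * norm (y - x)" by (rule Cauchy_Schwarz_ineq2)
    also have "\<dots> \<le> (L * e) * norm (y - x)" using g by (intro mult_right_mono) auto
    finally have "\<bar>(\<Sum>i\<in>I. lam i * \<phi> i y) - (\<Sum>i\<in>I. lam i * \<phi> i x)\<bar> \<le> (3 * L * e) * norm (y - x)"
      using 1 unfolding eq by (simp add: algebra_simps)
    also have "\<dots> \<le> \<eta> * norm (y - x)" using Le by (intro mult_right_mono) auto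
    finally show ?thesis .
  qed
  then show ?thesis using e by blast
qed

lemma closest_le: "y \<in> M \<Longrightarrow> norm (x - closest_point M x) \<le> norm (x - y)"
  using closest_point_le[OF closed_manifold, of y x] by (simp add: dist_norm)

lemma closest_near: "norm (closest_point M x - xb) \<le> 2 * norm (x - xb)"
proof -
  have "norm (closest_point M x - xb) \<le> norm (x - closest_point M x) + norm (x - xb)"
    using norm_triangle_ineq4[of "x - xb" "x - closest_point M x"] by (simp add: algebra_simps)
  then show ?thesis using closest_le[OF xb_in_manifold, of x] by linarith
qed

lemma closest_in_ball:
  assumes "x \<in> ball xb (e / 2)"
  shows "closest_point M x \<in> ball xb e"
  using assms closest_near[of x] by (simp add: dist_norm norm_minus_commute)

text \<open>Replacing the point \<open>z\<close> of \<open>error_bound\<close> by the projection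
  costs at most \<open>\<kappa> / 4\<close> times their distance, which is at most twice the
  distance from \<open>x\<close> to \<open>z\<close>. Half of the rate remains.\<close>

lemma sharpness:
  "\<exists>\<mu>>0. \<exists>e>0. \<forall>x\<in>ball xb e. \<mu> * norm (x - closest_point M x) \<le> f x - f (closest_point M x)"
proof -
  obtain \<kappa> where \<kappa>: "\<kappa> > 0" "\<And>\<rho>. \<rho> > 0 \<Longrightarrow>
      \<exists>e>0. \<forall>x\<in>ball xb e. \<exists>z\<in>M. z \<in> ball xb \<rho> \<and> \<kappa> * norm (x - z) \<le> f x - f z"
    using error_bound by blast
  obtain e1 where e1: "e1 > 0" "e1 \<le> r" "\<And>x y. x \<in> ball xb e1 \<Longrightarrow> y \<in> ball xb e1 \<Longrightarrow>
      \<bar>(\<Sum>i\<in>I. lam i * \<phi> i y) - (\<Sum>i\<in>I. lam i * \<phi> i x)\<bar> \<le> \<kappa> / 4 * norm (y - x)"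
    using weighted_sum_lipschitz[of "\<kappa> / 4"] \<kappa>(1) by auto
  \<comment> \<open>\<open>e1\<close> was chosen in terms of \<open>\<kappa>\<close>, which is why
    \<open>error_bound\<close> provides one \<open>\<kappa>\<close> for every
    \<open>\<rho>\<close>.\<close>
  obtain e2 where e2: "e2 > 0"
      "\<And>x. x \<in> ball xb e2 \<Longrightarrow> \<exists>z\<in>M. z \<in> ball xb e1 \<and> \<kappa> * norm (x - z) \<le> f x - f z"
    using \<kappa>(2)[OF e1(1)] by blast
  have "\<kappa> / 2 * norm (x - closest_point M x) \<le> f x - f (closest_point M x)"
    if x: "x \<in> ball xb (min e2 (e1 / 2))" for x
  proof -
    define p where "p = closest_point M x"
    have p: "p \<in> M" "p \<in> ball xb e1" "p \<in> ball xb r"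
      using closest_in_manifold closest_in_ball[of x e1] x e1 by (auto simp: p_def)
    obtain z where z: "z \<in> M" "z \<in> ball xb e1" "\<kappa> * norm (x - z) \<le> f x - f z"
      using e2(2)[of x] x by auto
    have "\<bar>f z - f p\<bar> \<le> \<kappa> / 4 * norm (z - p)"
      using e1(3)[OF p(2) z(2)] weighted_sum_eq p z(1,2) e1(2) by auto
    moreover have "norm (z - p) \<le> norm (x - p) + norm (x - z)"
      using norm_triangle_ineq4[of "x - p" "x - z"] by simp
    then have "\<kappa> / 4 * norm (z - p) \<le> \<kappa> / 4 * (norm (x - p) + norm (x - z))"
      using \<kappa>(1) by (intro mult_left_mono) auto
    moreover have "\<kappa> * norm (x - p) \<le> \<kappa> * norm (x - z)"
      using closest_le[OF z(1), of x] \<kappa>(1) by (intro mult_left_mono) (auto simp: p_def)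
    ultimately have "f p + \<kappa> * norm (x - p) / 2 \<le> f x" using z(3) unfolding distrib_left by argo
    then show ?thesis unfolding p_def by (simp add: algebra_simps)
  qed
  then show ?thesis using \<kappa>(1) e1(1) e2(1)
    by (intro exI[of _ "\<kappa> / 2"] conjI exI[of _ "min e2 (e1 / 2)"]) auto
qed

section \<open>The aiming condition\<close>

lemma gradient_bound: "\<exists>C>0. \<forall>i\<in>I. \<forall>x\<in>ball xb r. norm (G i x) \<le> C"
proof -
  define C where "C = (\<Sum>i\<in>I. norm (G i xb)) + L * r + 1"
  have "norm (G i x) \<le> C" if i: "i \<in> I" and x: "x \<in> ball xb r" for i x
  proof -
    have "norm (G i x) \<le> norm (G i xb) + norm (G i x - G i xb)" by (rule norm_triangle_sub)
    moreover have "norm (G i x - G i xb) \<le> L * norm (x - xb)" using lip[OF i x] r by simp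
    moreover have "L * norm (x - xb) \<le> L * r"
      using x L by (intro mult_left_mono) (auto simp: dist_norm norm_minus_commute)
    moreover have "norm (G i xb) \<le> (\<Sum>i\<in>I. norm (G i xb))" using fin i by (intro member_le_sum) auto
    ultimately show ?thesis by (simp add: C_def)
  qed
  moreover have "C > 0" using L r unfolding C_def by (intro add_nonneg_pos add_nonneg_nonneg sum_nonneg) auto
  ultimately show ?thesis by blast
qed

text \<open>Taylor expansion at \<open>y\<close> bounds the gradient along \<open>y - p\<close> from
  below through \<open>f y - f p\<close>; passing from \<open>y\<close> to \<open>x\<close> in value
  and direction costs a multiple of \<open>norm (y - x)\<close>.\<close>

lemma active_gradient_aiming:
  "\<exists>\<mu>>0. \<exists>C>0. \<exists>e>0. e \<le> r \<and> (\<forall>x\<in>ball xb e. \<forall>y\<in>ball xb e. \<forall>i\<in>active y.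
     \<mu> * norm (x - closest_point M x) - C * norm (y - x) \<le> G i y \<bullet> (x - closest_point M x))"
proof -
  obtain \<mu> e1 where \<mu>: "\<mu> > 0" and e1: "e1 > 0" "\<And>x. x \<in> ball xb e1 \<Longrightarrow>
      \<mu> * norm (x - closest_point M x) \<le> f x - f (closest_point M x)"
    using sharpness by blast
  obtain C where C: "C > 0" "\<And>i x. i \<in> I \<Longrightarrow> x \<in> ball xb r \<Longrightarrow> norm (G i x) \<le> C"
    using gradient_bound by blast
  \<comment> \<open>The projection lies within \<open>2 * e\<close> and \<open>y\<close> within
    \<open>e\<close> of \<open>xb\<close>, so they are at most \<open>3 * e\<close> apart; the
    Taylor error then uses up only half of \<open>\<mu>\<close>.\<close>
  define e where "e = min (min e1 (r / 2)) (\<mu> / (6 * L + 1))"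
  have e: "e > 0" "e \<le> e1" "e \<le> r / 2" "e \<le> \<mu> / (6 * L + 1)" using e1 r \<mu> L unfolding e_def by (simp, linarith+)
  have Le: "L * (3 * e) \<le> \<mu> / 2"
  proof -
    have "6 * L * e \<le> (6 * L + 1) * e" using e by (simp add: algebra_simps)
    also have "\<dots> \<le> (6 * L + 1) * (\<mu> / (6 * L + 1))" using L e(4) by (intro mult_left_mono) auto
    finally show ?thesis using L by simp
  qed
  \<comment> \<open>One \<open>C\<close> and \<open>L * (2 * r)\<close> bound
    \<open>f x - f y\<close>, the other \<open>C\<close> pays for the change of direction,
    \<open>\<mu> / 2\<close> for the Taylor error.\<close>
  define C' where "C' = 2 * C + L * (2 * r) + \<mu> / 2"
  have C': "C' > 0" using C(1) L r \<mu> by (simp add: C'_def add_pos_nonneg add_nonneg_pos)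
  have "\<mu> / 2 * norm (x - closest_point M x) - C' * norm (y - x) \<le> G i y \<bullet> (x - closest_point M x)"
    if x: "x \<in> ball xb e" and y: "y \<in> ball xb e" and i: "i \<in> active y" for x y i
  proof -
    define p where "p = closest_point M x"
    have p: "p \<in> M" "p \<in> ball xb (2 * e)" "p \<in> ball xb r"
      using closest_in_manifold closest_in_ball[of x "2 * e"] x e by (auto simp: p_def)
    have xr: "x \<in> ball xb r" "y \<in> ball xb r" using x y e r by auto
    have iI: "i \<in> I" and fy: "\<phi> i y = f y" using i by (auto simp: active_def)
    have fp: "\<phi> i p = f p" using f_on_manifold p iI by blast
    have CS: "\<bar>G j u \<bullet> (y - x)\<bar> \<le> C * norm (y - x)" if "j \<in> I" "u \<in> ball xb r" for j u
      using Cauchy_Schwarz_ineq2[of "G j u" "y - x"] mult_right_mono[OF C(2)[OF that] norm_ge_zero[of "y - x"]]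
      by linarith
    obtain k where k: "k \<in> I" "\<phi> k x = f x" using active_nonempty[OF xr(1)] by (auto simp: active_def)
    have "norm (y - x) \<le> 2 * r"
      using x y e r dist_triangle[of y x xb] by (auto simp: dist_norm norm_minus_commute)
    then have "L * norm (y - x) * norm (y - x) \<le> L * (2 * r) * norm (y - x)"
      using L by (intro mult_right_mono mult_left_mono) auto
    then have "L * (norm (y - x))\<^sup>2 \<le> L * (2 * r) * norm (y - x)"
      by (simp add: power2_eq_square mult.assoc)
    then have fyx: "f x - f y \<le> C * norm (y - x) + L * (2 * r) * norm (y - x)"
      using taylor[OF k(1) xr] phi_le[OF k(1) xr(2)] CS[OF k(1) xr(1)] k(2) by linarith
    have "norm (p - y) \<le> norm (x - p) + norm (y - x)"
      using norm_triangle_ineq4[of "x - y" "x - p"] by (simp add: norm_minus_commute)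
    moreover have "norm (p - y) \<le> 3 * e"
      using p(2) y dist_triangle[of p y xb] by (auto simp: dist_norm norm_minus_commute)
    ultimately have "norm (p - y) * norm (p - y) \<le> (3 * e) * (norm (x - p) + norm (y - x))"
      using e by (intro mult_mono) auto
    then have "L * (norm (p - y))\<^sup>2 \<le> (L * (3 * e)) * (norm (x - p) + norm (y - x))"
      using L by (simp add: power2_eq_square mult.assoc mult_left_mono)
    also have "\<dots> \<le> \<mu> / 2 * (norm (x - p) + norm (y - x))" using Le by (intro mult_right_mono) auto
    finally have "f y - f p - \<mu> / 2 * (norm (x - p) + norm (y - x)) \<le> G i y \<bullet> (y - p)"
      using taylor[OF iI xr(2) p(3)] fy fp by (simp add: inner_diff_right)
    moreover have "\<mu> * norm (x - p) \<le> f x - f p" using e1(2)[of x] x e(2) by (simp add: p_def)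
    moreover have "G i y \<bullet> (x - p) = G i y \<bullet> (y - p) - G i y \<bullet> (y - x)" by (simp add: inner_diff_right)
    ultimately have "\<mu> / 2 * norm (x - p) - C' * norm (y - x) \<le> G i y \<bullet> (x - p)"
      using fyx CS[OF iI xr(2)] unfolding C'_def by (simp add: algebra_simps)
    then show ?thesis by (simp add: p_def)
  qed
  then show ?thesis using \<mu> C' e r
    by (intro exI[of _ "\<mu> / 2"] conjI exI[of _ C'] exI[of _ e]) auto
qed

text \<open>At \<open>y = x\<close> the error term disappears, and the inequality extends from the
  active gradients to their hull because it cuts out a half-space.\<close>

lemma aiming: "aiming_condition f M xb"
proof -
  obtain \<mu> C e where c: "\<mu> > 0" "e > 0" "e \<le> r"
    "\<And>x y i. x \<in> ball xb e \<Longrightarrow> y \<in> ball xb e \<Longrightarrow> i \<in> active y \<Longrightarrow>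
     \<mu> * norm (x - closest_point M x) - C * norm (y - x) \<le> G i y \<bullet> (x - closest_point M x)"
    using active_gradient_aiming by blast
  have "\<mu> * infdist x M \<le> v \<bullet> (x - closest_point M x)"
    if x: "x \<in> ball xb e" and v: "v \<in> clarke_subdiff f x" for x v
  proof -
    have "v \<in> convex hull ((\<lambda>i. G i x) ` active x)" using clarke_subset[of x] v x c(3) by auto
    also have "\<dots> \<subseteq> {v. (x - closest_point M x) \<bullet> v \<ge> \<mu> * norm (x - closest_point M x)}"
      using c(4)[OF x x] by (intro hull_minimal convex_halfspace_ge) (auto simp: inner_commute)
    finally show ?thesis by (simp add: infdist_manifold dist_norm inner_commute)
  qed
  then show ?thesis unfolding aiming_condition_def using c(1,2)
    by (auto simp: eventually_nhds_metric dist_commute)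
qed

section \<open>Linear growth of the subgradients along the manifold\<close>

text \<open>The multipliers \<open>t\<close> of a small convex combination are close to \<open>lam\<close>, and the second-order
  term is read off the trapezoidal rule, which turns quadratic growth of the values into linear
  growth of the gradient.\<close>

lemma manifold_slope:
  "\<exists>c>0. \<exists>e>0. e \<le> r \<and> (\<forall>p\<in>M \<inter> ball xb e. \<forall>w\<in>convex hull ((\<lambda>i. G i p) ` I). c * norm (p - xb) \<le> norm w)"
proof -
  obtain S where S: "S > 0" "\<And>i. i \<in> I \<Longrightarrow> norm (W i) \<le> S" using dual_bound by blast
  \<comment> \<open>Bounds the sum over \<open>I\<close> of the deviations of \<open>t i\<close>
    from \<open>lam i\<close>, per unit of \<open>norm w + L * norm q\<close>.\<close>
  define N where "N = card I * S"
  have N: "N \<ge> 0" using S by (simp add: N_def)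
  obtain e1 where e1: "e1 > 0" "\<And>i y. i \<in> I \<Longrightarrow> y \<in> ball xb e1 \<Longrightarrow>
      \<bar>2 * (\<phi> i y - \<phi> i xb) - (G i y + G i xb) \<bullet> (y - xb)\<bar> \<le> \<delta> / 4 * (norm (y - xb))\<^sup>2"
    using trapezoid[of "\<delta> / 4"] \<delta> by auto
  have pos: "4 * (N * L * L) + 1 > 0" using N L by (intro add_nonneg_pos) auto
  \<comment> \<open>Lets the term cubic in \<open>norm q\<close> be absorbed into a quarter of the
    growth.\<close>
  define e where "e = min (min e1 r) (\<delta> / (4 * (N * L * L) + 1))"
  have e: "e > 0" "e \<le> e1" "e \<le> r" using e1 r \<delta> pos by (auto simp: e_def)
  have Le: "N * L * L * e \<le> \<delta> / 4"
  proof -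
    have "4 * (N * L * L) * e \<le> (4 * (N * L * L) + 1) * e" using e by (simp add: algebra_simps)
    also have "\<dots> \<le> (4 * (N * L * L) + 1) * (\<delta> / (4 * (N * L * L) + 1))"
      using pos by (intro mult_left_mono) (auto simp: e_def)
    finally show ?thesis using pos by simp
  qed
  define c where "c = \<delta> / 2 / (1 + N * L * r)"
  have pos': "1 + N * L * r > 0" using N L r by (intro add_pos_nonneg) auto
  have c: "c > 0" using \<delta> pos' by (simp add: c_def)
  have "c * norm (p - xb) \<le> norm w" if p: "p \<in> M" "p \<in> ball xb e" and w: "w \<in> convex hull ((\<lambda>i. G i p) ` I)" for p w
  proof -
    obtain t where t: "\<And>i. i \<in> I \<Longrightarrow> 0 \<le> t i" "sum t I = 1" "w = (\<Sum>i\<in>I. t i *\<^sub>R G i p)"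
      using w unfolding convex_hull_image_finite[OF fin] by blast
    define q where "q = p - xb"
    have pr: "p \<in> ball xb r" "p \<in> ball xb e1" "xb \<in> ball xb r" using p e r by auto
    have q: "norm q \<le> e" "norm q \<le> r" using p e by (auto simp: q_def dist_norm norm_minus_commute)
    \<comment> \<open>\<open>w\<close> and \<open>g\<close> carry the same weights at
      \<open>p\<close> and at \<open>xb\<close>, as the trapezoidal rule for the combination with
      frozen weights \<open>t\<close> requires.\<close>
    define g where "g = (\<Sum>i\<in>I. t i *\<^sub>R G i xb)"
    have fp: "\<phi> i p = f p" "\<phi> i xb = f xb" if "i \<in> I" for i
      using f_on_manifold p(1) pr xb_in_manifold that by blast+
    have wg: "norm (w - g) \<le> L * norm q"
    proof -
      have "norm (w - g) = norm (\<Sum>i\<in>I. t i *\<^sub>R (G i p - G i xb))"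
        by (simp add: t(3) g_def scaleR_diff_right sum_subtractf)
      also have "\<dots> \<le> (\<Sum>i\<in>I. t i * (L * norm q))"
        using lip[OF _ pr(1,3)] t(1) by (intro sum_norm_le) (auto intro!: mult_left_mono simp: q_def)
      also have "\<dots> = L * norm q" using t(2) by (simp flip: sum_distrib_right)
      finally show ?thesis .
    qed
    \<comment> \<open>Pairing \<open>g\<close> with \<open>W i\<close> reads off
      \<open>t i - lam i\<close>, by \<open>gradient_inner_dual\<close>.\<close>
    have tl: "\<bar>t i - lam i\<bar> \<le> S * (norm w + L * norm q)" if i: "i \<in> I" for i
    proof -
      have "g \<bullet> W i = (\<Sum>j\<in>I. (if i = j then t i else 0) - t j * lam i)"
        unfolding g_def inner_sum_left
        by (intro sum.cong) (auto simp: gradient_inner_dual[OF i] right_diff_distrib)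
      also have "\<dots> = t i - lam i"
        using fin i t(2) by (simp add: sum_subtractf flip: sum_distrib_right)
      finally have "\<bar>t i - lam i\<bar> \<le> norm g * norm (W i)" using Cauchy_Schwarz_ineq2 by metis
      also have "\<dots> \<le> (norm w + L * norm q) * S"
      proof (intro mult_mono S(2) i)
        show "norm g \<le> norm w + L * norm q"
          using wg norm_triangle_ineq4[of w "w - g"] by simp
      qed (use L in auto)
      finally show ?thesis by (simp add: mult.commute)
    qed
    have gq: "\<bar>g \<bullet> q\<bar> \<le> N * (norm w + L * norm q) * (L * (norm q)\<^sup>2)"
    proof -
      \<comment> \<open>The weights \<open>t i - lam i\<close> sum to 0, so the common increment
        \<open>f p - f xb\<close> may be subtracted from every term; each factor is then a
        second-order Taylor remainder.\<close>
      have sum0: "(\<Sum>i\<in>I. (t i - lam i) * (f p - f xb)) = 0"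
        using t(2) lam_sum by (simp add: sum_subtractf flip: sum_distrib_right)
      have "g \<bullet> q = (\<Sum>i\<in>I. (t i - lam i) *\<^sub>R G i xb) \<bullet> q"
        using lam_zero by (simp add: g_def scaleR_diff_left sum_subtractf)
      also have "\<dots> = (\<Sum>i\<in>I. (t i - lam i) * (G i xb \<bullet> q - (f p - f xb)))"
        using sum0 by (simp add: inner_sum_left right_diff_distrib sum_subtractf)
      also have "\<bar>\<dots>\<bar> \<le> (\<Sum>i\<in>I. (S * (norm w + L * norm q)) * (L * (norm q)\<^sup>2))"
      proof (rule order_trans[OF sum_abs], rule sum_mono)
        fix i assume i: "i \<in> I"
        have "\<bar>G i xb \<bullet> q - (f p - f xb)\<bar> \<le> L * (norm q)\<^sup>2"
          using taylor[OF i pr(3,1)] fp[OF i] unfolding q_def by linarith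
        then show "\<bar>(t i - lam i) * (G i xb \<bullet> q - (f p - f xb))\<bar> \<le>
            (S * (norm w + L * norm q)) * (L * (norm q)\<^sup>2)"
          using tl[OF i] S(1) L unfolding abs_mult by (intro mult_mono) auto
      qed
      finally show ?thesis by (simp add: N_def mult.assoc)
    qed
    have "\<bar>2 * (f p - f xb) - (w + g) \<bullet> q\<bar> \<le> \<delta> / 4 * (norm q)\<^sup>2"
    proof -
      have "2 * (f p - f xb) - (w + g) \<bullet> q =
          (\<Sum>i\<in>I. t i * (2 * (f p - f xb))) - (\<Sum>i\<in>I. t i * ((G i p + G i xb) \<bullet> q))"
        using t(2) by (simp add: t(3) g_def inner_sum_left inner_add_left distrib_left sum.distrib
            flip: sum_distrib_right)
      also have "\<dots> = (\<Sum>i\<in>I. t i * (2 * (\<phi> i p - \<phi> i xb) - (G i p + G i xb) \<bullet> q))"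
        using fp by (simp add: right_diff_distrib sum_subtractf)
      also have "\<bar>\<dots>\<bar> \<le> (\<Sum>i\<in>I. t i * (\<delta> / 4 * (norm q)\<^sup>2))"
      proof (rule order_trans[OF sum_abs], rule sum_mono)
        fix i assume i: "i \<in> I"
        show "\<bar>t i * (2 * (\<phi> i p - \<phi> i xb) - (G i p + G i xb) \<bullet> q)\<bar> \<le> t i * (\<delta> / 4 * (norm q)\<^sup>2)"
          using mult_left_mono[OF e1(2)[OF i pr(2)] t(1)[OF i]] t(1)[OF i]
          unfolding q_def abs_mult by (simp only: abs_of_nonneg)
      qed
      also have "\<dots> = \<delta> / 4 * (norm q)\<^sup>2" using t(2) by (simp only: sum_distrib_right[symmetric])
      finally show ?thesis .
    qed
    moreover have "\<delta> * (norm q)\<^sup>2 \<le> 2 * (f p - f xb)" using growth[OF pr(1)] by (simp add: q_def)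
    moreover have "w \<bullet> q \<le> norm w * norm q" by (rule norm_cauchy_schwarz)
    moreover have "N * (norm w + L * norm q) * (L * (norm q)\<^sup>2) \<le>
        N * L * r * norm w * norm q + \<delta> / 4 * (norm q)\<^sup>2"
    proof -
      have "(N * L * norm w * norm q) * norm q \<le> (N * L * norm w * norm q) * r"
        using q N L by (intro mult_left_mono) auto
      moreover have "(N * L * L) * norm q \<le> (N * L * L) * e" using q N L by (intro mult_left_mono) auto
      then have "(N * L * L * norm q) * (norm q)\<^sup>2 \<le> \<delta> / 4 * (norm q)\<^sup>2"
        using Le by (intro mult_right_mono) auto
      ultimately show ?thesis by (simp add: algebra_simps power2_eq_square)
    qed
    \<comment> \<open>Growth supplies \<open>\<delta>\<close>; a quarter goes to the trapezoidal
      error, a quarter to the cubic term.\<close>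
    ultimately have "\<delta> / 2 * (norm q)\<^sup>2 \<le> norm w * norm q + N * L * r * norm w * norm q"
      using gq unfolding inner_add_left by linarith
    then have "(\<delta> / 2 * norm q) * norm q \<le> ((1 + N * L * r) * norm w) * norm q"
      by (simp add: algebra_simps power2_eq_square)
    then have "\<delta> / 2 * norm q \<le> (1 + N * L * r) * norm w"
      using pos' by (cases "q = 0") auto
    then show ?thesis using pos' by (simp add: c_def q_def field_simps)
  qed
  then show ?thesis using c e by blast
qed

section \<open>Linear growth of the Goldstein modulus\<close>

lemma goldstein_lower_bound:
  "\<exists>\<alpha>>0. \<alpha> \<le> 1 \<and> (\<exists>e>0. \<forall>x\<in>ball xb e. \<forall>\<epsilon>\<ge>0. \<epsilon> < \<alpha> * norm (x - xb) \<longrightarrow>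
     (\<forall>v\<in>goldstein_subdiff \<epsilon> f x. \<epsilon> < norm v))"
proof -
  obtain \<mu> C e1 where \<mu>: "\<mu> > 0" and C: "C > 0" and e1: "e1 > 0" "e1 \<le> r"
    "\<And>x y i. x \<in> ball xb e1 \<Longrightarrow> y \<in> ball xb e1 \<Longrightarrow> i \<in> active y \<Longrightarrow>
     \<mu> * norm (x - closest_point M x) - C * norm (y - x) \<le> G i y \<bullet> (x - closest_point M x)"
    using active_gradient_aiming by blast
  obtain c e2 where c: "c > 0" and e2: "e2 > 0" "e2 \<le> r" "\<And>p w. p \<in> M \<Longrightarrow> p \<in> ball xb e2 \<Longrightarrow>
      w \<in> convex hull ((\<lambda>i. G i p) ` I) \<Longrightarrow> c * norm (p - xb) \<le> norm w"
    using manifold_slope by blast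
  \<comment> \<open>Threshold between the two cases: if \<open>\<beta> * \<epsilon> \<le> d\<close>,
    the loss \<open>C * \<epsilon>\<close> is at most half of \<open>\<mu> * d\<close>.\<close>
  define \<beta> where "\<beta> = 2 * C / \<mu>"
  \<comment> \<open>The three terms stand for \<open>\<epsilon>\<close> itself, the thickness of
    \<open>T\<close> below, and the step from \<open>x\<close> to \<open>p\<close>, so
    \<open>D * \<epsilon> < c * norm (x - xb)\<close> leaves
    \<open>\<epsilon> < norm v\<close>.\<close>
  define D where "D = 1 + L * (1 + \<beta>) + c * \<beta>"
  have \<beta>: "\<beta> > 0" using C \<mu> by (simp add: \<beta>_def)
  have D: "D > 0" using L \<beta> c unfolding D_def by (intro add_pos_pos add_pos_nonneg) auto
  define \<alpha> where "\<alpha> = min 1 (c / D)"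
  have \<alpha>: "\<alpha> > 0" "\<alpha> \<le> 1" using c D by (auto simp: \<alpha>_def)
  \<comment> \<open>In the far case \<open>norm v\<close> is at least \<open>\<mu> / 2\<close>; the
    last bound on \<open>e\<close> makes that exceed \<open>\<epsilon>\<close>.\<close>
  define e where "e = min (min (e1 / 2) (e2 / 2)) (\<mu> / 2)"
  have e: "e > 0" "e \<le> e1 / 2" "e \<le> e2 / 2" "e \<le> \<mu> / 2" using e1 e2 \<mu> by (auto simp: e_def)
  have "\<epsilon> < norm v" if x: "x \<in> ball xb e" and \<epsilon>: "0 \<le> \<epsilon>" "\<epsilon> < \<alpha> * norm (x - xb)"
    and v: "v \<in> goldstein_subdiff \<epsilon> f x" for x \<epsilon> v
  proof -
    define p where "p = closest_point M x"
    define d where "d = norm (x - p)"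
    have nx: "norm (x - xb) < e" using x by (simp add: dist_norm norm_minus_commute)
    have "\<alpha> * norm (x - xb) \<le> norm (x - xb)" using \<alpha> by (intro mult_left_le_one_le) auto
    then have \<epsilon>x: "\<epsilon> < norm (x - xb)" using \<epsilon>(2) by linarith
    have p: "p \<in> M" "p \<in> ball xb e2" "p \<in> ball xb r"
      using closest_in_manifold closest_in_ball[of x e2] x e e2 by (auto simp: p_def)
    have xe1: "x \<in> ball xb e1" using x e e1 by auto
    have ye1: "y \<in> ball xb e1" and yr: "y \<in> ball xb r" and yx: "norm (y - x) \<le> \<epsilon>" if "y \<in> cball x \<epsilon>" for y
    proof -
      have "dist xb y \<le> dist xb x + dist x y" by (rule dist_triangle)
      moreover have "dist xb x < e1 / 2" "dist x y < e1 / 2"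
        using that nx \<epsilon>x e by (auto simp: dist_norm norm_minus_commute)
      ultimately show "y \<in> ball xb e1" by simp
      then show "y \<in> ball xb r" using e1 by simp
      show "norm (y - x) \<le> \<epsilon>" using that by (simp add: dist_norm norm_minus_commute)
    qed
    show ?thesis
    proof (cases "\<beta> * \<epsilon> \<le> d \<and> d > 0")
      case True
      have "C * \<epsilon> \<le> \<mu> / 2 * d" using True \<mu> by (simp add: \<beta>_def field_simps)
      have "G i y \<bullet> (x - p) \<ge> \<mu> / 2 * d" if y: "y \<in> cball x \<epsilon>" and i: "i \<in> active y" for y i
      proof -
        have "C * norm (y - x) \<le> C * \<epsilon>" using yx[OF y] C by (intro mult_left_mono) auto
        then show ?thesis using e1(3)[OF xe1 ye1[OF y] i] \<open>C * \<epsilon> \<le> \<mu> / 2 * d\<close>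
          unfolding p_def[symmetric] d_def by linarith
      qed
      then have "(\<lambda>i. G i y) ` active y \<subseteq> {v. (x - p) \<bullet> v \<ge> \<mu> / 2 * d}" if "y \<in> cball x \<epsilon>" for y
        using that by (auto simp: inner_commute)
      then have "clarke_subdiff f y \<subseteq> {v. (x - p) \<bullet> v \<ge> \<mu> / 2 * d}" if "y \<in> cball x \<epsilon>" for y
        using clarke_subset[OF yr[OF that]] hull_minimal[where S = convex, OF _ convex_halfspace_ge] that
        by (blast dest: subset_trans)
      then have "goldstein_subdiff \<epsilon> f x \<subseteq> {v. (x - p) \<bullet> v \<ge> \<mu> / 2 * d}"
        unfolding goldstein_subdiff_def by (intro hull_minimal convex_halfspace_ge UN_least)
      then have "\<mu> / 2 * d \<le> (x - p) \<bullet> v" using v by blast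
      also have "\<dots> \<le> d * norm v" unfolding d_def by (rule norm_cauchy_schwarz)
      finally have "\<mu> / 2 \<le> norm v" using True by (simp add: mult.commute)
      then show ?thesis using \<epsilon>x nx e by linarith
    next
      case False
      then have d: "d \<le> \<beta> * \<epsilon>" using \<beta> \<epsilon> by (auto simp: d_def not_le)
      \<comment> \<open>A convex set plus a ball is convex, so once \<open>T\<close> contains every
        subdifferential over the ball it contains the Goldstein hull.\<close>
      define T where "T = (\<Union>w\<in>convex hull ((\<lambda>i. G i p) ` I). \<Union>b\<in>cball 0 (L * (1 + \<beta>) * \<epsilon>). {w + b})"
      have "convex T" unfolding T_def by (intro convex_sums convex_convex_hull convex_cball)
      moreover have "clarke_subdiff f y \<subseteq> T" if y: "y \<in> cball x \<epsilon>" for y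
      proof
        fix u assume "u \<in> clarke_subdiff f y"
        then have "u \<in> convex hull ((\<lambda>i. G i y) ` I)"
          using clarke_subset[OF yr[OF y]] active_subset by (metis hull_mono image_mono subsetD)
        then obtain w where w: "w \<in> convex hull ((\<lambda>i. G i p) ` I)" "norm (u - w) \<le> L * norm (y - p)"
          using convex_combination_near[OF p(3) yr[OF y]] by blast
        have "norm (y - p) \<le> (1 + \<beta>) * \<epsilon>"
          using norm_triangle_ineq[of "y - x" "x - p"] yx[OF y] d by (simp add: d_def algebra_simps)
        then have "L * norm (y - p) \<le> L * (1 + \<beta>) * \<epsilon>" using L by (simp add: mult.assoc mult_left_mono)
        then have "u - w \<in> cball 0 (L * (1 + \<beta>) * \<epsilon>)" using w(2) by simp
        then show "u \<in> T" using w(1) unfolding T_def by force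
      qed
      ultimately have "goldstein_subdiff \<epsilon> f x \<subseteq> T"
        unfolding goldstein_subdiff_def by (intro hull_minimal UN_least)
      then obtain w b where w: "w \<in> convex hull ((\<lambda>i. G i p) ` I)" "norm b \<le> L * (1 + \<beta>) * \<epsilon>" "v = w + b"
        using v unfolding T_def by fastforce
      have "c * norm (p - xb) \<le> norm w" by (rule e2(3)[OF p(1,2) w(1)])
      moreover have "norm w \<le> norm v + norm b" using norm_triangle_ineq4[of v b] w(3) by simp
      moreover have "norm (x - xb) \<le> norm (p - xb) + \<beta> * \<epsilon>"
        using norm_triangle_ineq[of "x - p" "p - xb"] d by (simp add: d_def)
      then have "c * norm (x - xb) \<le> c * (norm (p - xb) + \<beta> * \<epsilon>)" using c by (intro mult_left_mono) auto
      moreover have "D * \<epsilon> < c * norm (x - xb)"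
      proof -
        have "\<epsilon> < c / D * norm (x - xb)"
          using \<epsilon>(2) mult_right_mono[of \<alpha> "c / D" "norm (x - xb)"] by (simp add: \<alpha>_def)
        then show ?thesis using D by (simp add: field_simps)
      qed
      ultimately show ?thesis using w(2) by (simp add: D_def algebra_simps)
    qed
  qed
  then show ?thesis using \<alpha> e(1) by blast
qed

text \<open>Makes the shortest vector an element of the hull. The generators are grouped by index:
  for each \<open>i\<close> they form the continuous image of the compact set of points of the ball
  where \<open>i\<close> is active.\<close>

lemma goldstein_compact:
  "\<exists>e>0. \<forall>x \<epsilon>. \<epsilon> \<ge> 0 \<longrightarrow> cball x \<epsilon> \<subseteq> ball xb e \<longrightarrow>
     compact (goldstein_subdiff \<epsilon> f x) \<and> goldstein_subdiff \<epsilon> f x \<noteq> {}"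
proof -
  obtain e where e: "e > 0" "e \<le> r"
      "\<And>x. x \<in> ball xb e \<Longrightarrow> clarke_subdiff f x = convex hull ((\<lambda>i. G i x) ` active x)"
    using clarke_eq by blast
  have "compact (goldstein_subdiff \<epsilon> f x) \<and> goldstein_subdiff \<epsilon> f x \<noteq> {}"
    if \<epsilon>: "\<epsilon> \<ge> 0" and sub: "cball x \<epsilon> \<subseteq> ball xb e" for x \<epsilon>
  proof -
    define T where "T = (\<Union>i\<in>I. G i ` {y \<in> cball x \<epsilon>. \<phi> i y = f y})"
    have T: "T = (\<Union>y\<in>cball x \<epsilon>. (\<lambda>i. G i y) ` active y)" unfolding T_def active_def by blast
    have "goldstein_subdiff \<epsilon> f x = convex hull T"
    proof
      have "clarke_subdiff f y \<subseteq> convex hull T" if y: "y \<in> cball x \<epsilon>" for y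
      proof -
        have "y \<in> ball xb e" using y sub by blast
        moreover have "(\<lambda>i. G i y) ` active y \<subseteq> T" unfolding T using y by blast
        ultimately show ?thesis using e(3) by (simp add: hull_mono)
      qed
      then show "goldstein_subdiff \<epsilon> f x \<subseteq> convex hull T"
        unfolding goldstein_subdiff_def by (intro hull_minimal convex_convex_hull UN_least)
      have "(\<lambda>i. G i y) ` active y \<subseteq> clarke_subdiff f y" if y: "y \<in> cball x \<epsilon>" for y
      proof -
        have "y \<in> ball xb e" using y sub by blast
        then show ?thesis using e(3) by (simp add: hull_subset)
      qed
      then show "convex hull T \<subseteq> goldstein_subdiff \<epsilon> f x"
        unfolding goldstein_subdiff_def T by (intro hull_mono) blast
    qed
    moreover have "compact (G i ` {y \<in> cball x \<epsilon>. \<phi> i y = f y})" if i: "i \<in> I" for i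
    proof (rule compact_continuous_image)
      show "continuous_on {y \<in> cball x \<epsilon>. \<phi> i y = f y} (G i)"
        using isCont_G[OF i] sub e(2) by (intro continuous_at_imp_continuous_on ballI) auto
      have "continuous_on UNIV (\<phi> i)" using isCont_phi[OF i] continuous_at_imp_continuous_on by blast
      then have "closed {y. \<phi> i y = f y}" using contf by (intro closed_Collect_eq)
      then have "compact (cball x \<epsilon> \<inter> {y. \<phi> i y = f y})" by (intro compact_Int_closed compact_cball)
      moreover have "cball x \<epsilon> \<inter> {y. \<phi> i y = f y} = {y \<in> cball x \<epsilon>. \<phi> i y = f y}" by blast
      ultimately show "compact {y \<in> cball x \<epsilon>. \<phi> i y = f y}" by simp
    qed
    then have "compact T" unfolding T_def using fin by (intro compact_UN) auto
    moreover have "x \<in> cball x \<epsilon>" using \<epsilon> by simp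
    then have "x \<in> ball xb e" using sub by blast
    then have "active x \<noteq> {}" using active_nonempty[of x] e(2) by simp
    then have "T \<noteq> {}" unfolding T using \<open>x \<in> cball x \<epsilon>\<close> by blast
    ultimately show ?thesis by (simp add: compact_convex_hull)
  qed
  then show ?thesis using e(1) by blast
qed

lemma zero_in_clarke: "0 \<in> clarke_subdiff f xb"
proof -
  obtain e where e: "e > 0" "e \<le> r"
      "\<And>x. x \<in> ball xb e \<Longrightarrow> clarke_subdiff f x = convex hull ((\<lambda>i. G i x) ` active x)"
    using clarke_eq by blast
  have "active xb = I" using active_on_manifold[of xb] xb_in_manifold r by simp
  then have "clarke_subdiff f xb = convex hull ((\<lambda>i. G i xb) ` I)" using e by simp
  moreover have "(\<Sum>i\<in>I. lam i *\<^sub>R G i xb) \<in> convex hull ((\<lambda>i. G i xb) ` I)"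
    using lam_pos lam_sum fin unfolding convex_hull_image_finite[OF fin] by (force intro: less_imp_le)
  ultimately show ?thesis using lam_zero by simp
qed

lemma goldstein_modulus_growth:
  "\<exists>\<alpha>>0. \<forall>\<^sub>F x in nhds xb. goldstein_modulus f x \<ge> \<alpha> * norm (x - xb)"
proof -
  obtain \<alpha> e1 where \<alpha>: "\<alpha> > 0" "\<alpha> \<le> 1" and e1: "e1 > 0"
    "\<And>x \<epsilon> v. x \<in> ball xb e1 \<Longrightarrow> \<epsilon> \<ge> 0 \<Longrightarrow> \<epsilon> < \<alpha> * norm (x - xb) \<Longrightarrow>
      v \<in> goldstein_subdiff \<epsilon> f x \<Longrightarrow> \<epsilon> < norm v"
    using goldstein_lower_bound by blast
  obtain e2 where e2: "e2 > 0" "\<And>x \<epsilon>. \<epsilon> \<ge> 0 \<Longrightarrow> cball x \<epsilon> \<subseteq> ball xb e2 \<Longrightarrow>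
     compact (goldstein_subdiff \<epsilon> f x) \<and> goldstein_subdiff \<epsilon> f x \<noteq> {}"
    using goldstein_compact by blast
  define e where "e = min e1 (e2 / 2)"
  have "goldstein_modulus f x \<ge> \<alpha> * norm (x - xb)" if x: "x \<in> ball xb e" for x
    unfolding goldstein_modulus_def
  proof (rule cInf_greatest)
    \<comment> \<open>\<open>Inf\<close> of an empty set of reals says nothing, so an admissible
      radius is exhibited: the ball of radius \<open>norm (x - xb)\<close> reaches the critical
      point \<open>xb\<close>.\<close>
    have "0 \<in> goldstein_subdiff (norm (x - xb)) f x"
      unfolding goldstein_subdiff_def using zero_in_clarke
      by (intro hull_inc UN_I[of xb]) (auto simp: dist_norm)
    then have "goldstein_subgradient (norm (x - xb)) f x = 0"
      by (simp add: goldstein_subgradient_def closest_point_self)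
    then have "norm (x - xb) \<in> {\<epsilon>. 0 \<le> \<epsilon> \<and> norm (goldstein_subgradient \<epsilon> f x) \<le> \<epsilon>}" by simp
    then show "{\<epsilon>. 0 \<le> \<epsilon> \<and> norm (goldstein_subgradient \<epsilon> f x) \<le> \<epsilon>} \<noteq> {}" by blast
  next
    fix \<epsilon> assume "\<epsilon> \<in> {\<epsilon>. 0 \<le> \<epsilon> \<and> norm (goldstein_subgradient \<epsilon> f x) \<le> \<epsilon>}"
    then have \<epsilon>: "0 \<le> \<epsilon>" "norm (goldstein_subgradient \<epsilon> f x) \<le> \<epsilon>" by auto
    show "\<alpha> * norm (x - xb) \<le> \<epsilon>"
    proof (rule ccontr)
      assume "\<not> \<alpha> * norm (x - xb) \<le> \<epsilon>"
      then have less: "\<epsilon> < \<alpha> * norm (x - xb)" by simp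
      also have "\<dots> \<le> norm (x - xb)" using \<alpha> by (intro mult_left_le_one_le) auto
      also have "\<dots> < e2 / 2" using x by (simp add: e_def dist_norm norm_minus_commute)
      finally have "\<epsilon> < e2 / 2" .
      moreover have "dist xb x < e2 / 2" using x by (simp add: e_def)
      ultimately have "cball x \<epsilon> \<subseteq> ball xb e2"
        by (intro subsetI) (use dist_triangle[of xb _ x] in \<open>smt (verit) mem_ball mem_cball field_sum_of_halves\<close>)
      then have "goldstein_subgradient \<epsilon> f x \<in> goldstein_subdiff \<epsilon> f x"
        unfolding goldstein_subgradient_def
        using e2(2)[OF \<epsilon>(1)] compact_imp_closed closest_point_in_set by blast
      then have "\<epsilon> < norm (goldstein_subgradient \<epsilon> f x)"
        using e1(2)[OF _ \<epsilon>(1) less] x by (simp add: e_def)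
      then show False using \<epsilon>(2) by simp
    qed
  qed
  then show ?thesis using \<alpha>(1) e1(1) e2(1)
    by (intro exI[of _ \<alpha>] conjI) (auto simp: eventually_nhds_metric dist_commute e_def intro!: exI[of _ e])
qed

end

section \<open>Passage from the definitions to the two locales\<close>

theorem theorem6p4:
  fixes f :: "'a::euclidean_space \<Rightarrow> real"
    and I :: "'i set" and \<phi> :: "'i \<Rightarrow> 'a \<Rightarrow> real"
    and xb :: 'a and M :: "'a set"
  assumes "locally_lipschitz f"
    and "strong_C2_max f I \<phi> xb"
    and "M = active_manifold I \<phi>"
  shows "grows_robustly f M xb \<and>
    (\<exists>\<alpha>>0. \<forall>\<^sub>F x in nhds xb. goldstein_modulus f x \<ge> \<alpha> * norm (x - xb))"
proof -
  let ?g = "\<lambda>i. gradient (\<phi> i) xb"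
  have relint: "0 \<in> rel_interior (clarke_subdiff f xb)"
    and quad: "grows_quadratically f xb" and fin: "finite I" and ne: "I \<noteq> {}"
    and C2: "\<And>i. i \<in> I \<Longrightarrow> C2_on UNIV (\<phi> i)"
    and max: "\<forall>\<^sub>F x in nhds xb. f x = Max ((\<lambda>i. \<phi> i x) ` I)"
    and common: "\<And>i j. i \<in> I \<Longrightarrow> j \<in> I \<Longrightarrow> \<phi> i xb = \<phi> j xb"
    and inj: "inj_on ?g I" and indep: "\<not> affine_dependent (?g ` I)"
    using assms(2) unfolding strong_C2_max_def by blast+
  obtain e1 L where e1: "e1 > 0" and L: "L \<ge> 0" and
    lip: "\<And>i y z. i \<in> I \<Longrightarrow> y \<in> ball xb e1 \<Longrightarrow> z \<in> ball xb e1 \<Longrightarrow>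
      norm (gradient (\<phi> i) y - gradient (\<phi> i) z) \<le> L * norm (y - z)"
    using C2_family_uniform_lipschitz[of I \<phi> xb, OF fin C2] by blast
  obtain e2 where e2: "e2 > 0" "\<And>x. x \<in> ball xb e2 \<Longrightarrow> f x = Max ((\<lambda>i. \<phi> i x) ` I)"
    using max unfolding eventually_nhds_metric by (auto simp: dist_commute)
  obtain \<delta> e3 where \<delta>: "\<delta> > 0" and e3: "e3 > 0"
      "\<And>x. x \<in> ball xb e3 \<Longrightarrow> \<delta> / 2 * (norm (x - xb))\<^sup>2 \<le> f x - f xb"
    using quad unfolding grows_quadratically_def eventually_nhds_metric by (auto simp: dist_commute)
  define r where "r = min e1 (min e2 e3)"
  obtain W where W: "\<And>i j k. i \<in> I \<Longrightarrow> j \<in> I \<Longrightarrow> k \<in> I \<Longrightarrow>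
      (?g j - ?g k) \<bullet> W i = (if i = j then 1 else 0) - (if i = k then 1 else 0)"
    using affine_independent_dual_vectors[OF fin inj indep] by blast
  interpret max_family f I \<phi> xb r L W
  proof
    show "GDERIV (\<phi> i) x :> gradient (\<phi> i) x" if "i \<in> I" for i x
      using C2_on_GDERIV[OF C2[OF that]] by blast
    show "continuous_on UNIV f" by (rule locally_lipschitz_continuous[OF assms(1)])
    show "\<phi> i xb = \<phi> j xb" if "i \<in> I" "j \<in> I" for i j using common that .
    show "(?g j - ?g k) \<bullet> W i = (if i = j then 1 else 0) - (if i = k then 1 else 0)"
      if "i \<in> I" "j \<in> I" "k \<in> I" for i j k using W that .
  qed (use fin ne e1 e2 e3 L lip in \<open>auto simp: r_def\<close>)
  obtain e where "e > 0"
      "\<And>x. x \<in> ball xb e \<Longrightarrow> clarke_subdiff f x = convex hull ((\<lambda>i. G i x) ` active x)"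
    using clarke_eq by blast
  moreover have "active xb = I" using active_on_manifold[of xb] xb_in_manifold r by simp
  ultimately have "clarke_subdiff f xb = convex hull (?g ` I)" by simp
  then have "0 \<in> rel_interior (convex hull (?g ` I))" using relint by (simp only:)
  \<comment> \<open>By affine independence a point of the relative interior has positive barycentric
    weights. \<open>u\<close> lives on the gradients; injectivity turns it into weights on
    \<open>I\<close>.\<close>
  then obtain u where "\<forall>y\<in>?g ` I. 0 < u y" and u: "sum u (?g ` I) = 1"
      "(\<Sum>y\<in>?g ` I. u y *\<^sub>R y) = 0"
    unfolding rel_interior_convex_hull_explicit[OF indep] by blast
  then have upos: "\<And>i. i \<in> I \<Longrightarrow> 0 < u (?g i)" by blast
  interpret sharp_max_family f I \<phi> xb r L W "\<lambda>i. u (?g i)" \<delta>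
  proof
    show "(\<Sum>i\<in>I. u (?g i)) = 1" using u(1) by (simp add: sum.reindex[OF inj])
    show "(\<Sum>i\<in>I. u (?g i) *\<^sub>R ?g i) = 0" using u(2) by (simp add: sum.reindex[OF inj])
    show "\<exists>e>0. \<forall>i\<in>I. \<forall>y\<in>ball xb e. \<bar>2 * (\<phi> i y - \<phi> i xb) -
        (gradient (\<phi> i) y + gradient (\<phi> i) xb) \<bullet> (y - xb)\<bar> \<le> \<eta> * (norm (y - xb))\<^sup>2" if "\<eta> > 0" for \<eta>
      using C2_family_uniform_trapezoid[OF fin C2 that] .
  qed (use upos \<delta> e3 in \<open>auto simp: r_def\<close>)
  \<comment> \<open>Any single \<open>\<phi> a\<close> agrees with \<open>f\<close> on the manifold
    near \<open>xb\<close> and serves as the smooth extension.\<close>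
  obtain a where a: "a \<in> I" using ne by blast
  have "C2_restriction_around M f xb"
    unfolding C2_restriction_around_def
  proof (intro exI conjI)
    show "C2_on (ball xb r) (\<phi> a)" using C2_on_subset[OF C2[OF a]] by blast
    show "\<forall>y\<in>M \<inter> ball xb r. f y = \<phi> a y" using f_on_manifold a assms(3) by auto
  qed (use r in auto)
  moreover have "C2_manifold_around M xb"
    unfolding assms(3) by (rule active_manifold_C2[OF fin ne C2 xb_in_manifold inj indep])
  ultimately have "grows_robustly f M xb"
    unfolding grows_robustly_def assms(3)
    using assms(1) quad regular_on_manifold upper_lipschitz aiming by blast
  then show ?thesis using goldstein_modulus_growth by blast
qed

end
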